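(* The theory $\mathsf{MC}_A:=\mathsf{OA}+\mathsf{MU}+\mathsf{TDC}+\mathsf{UE}$ proves that there exists a maximal regular encoding of all bounded classes, i.e. it proves $$\exists E\,\bigl(\operatorname{isRegEncoding}(E)\wedge\forall g\,\exists\alpha\,\forall\beta\,(\beta\in g\leftrightarrow\operatorname{Pair}(\beta,\alpha)\in E)\bigr),$$ where $g$ ranges over bounded classes.
   Context: $\mathsf{OA}$ is the following theory in the monadic second-order language with first-order variables $\alpha,\beta,\dots$ (ordinals), second-order variables $X,Y,\dots$ (classes of ordinals), symbols $<,+,\times$ on ordinals and $\in$ between ordinals and classes. Axioms: (1) $<$ is a strict linear order; there is $\alpha$ with $\exists\beta(\beta<\alpha)$ and $\forall\beta<\alpha\,\exists\gamma<\alpha\,(\beta<\gamma)$; every non-empty class has a $<$-least element. (2) Replacement Schema: for every formula $\varphi(\gamma,\delta)$ (with first- and second-order parameters), $\forall\alpha(\forall\gamma<\alpha\,\exists!\delta\,\varphi(\gamma,\delta)\to\exists\beta\,\forall\gamma<\alpha\,\exists\delta<\beta\,\varphi(\gamma,\delta))$. (3) Extensionality for classes. (4) Comprehension Schema: for every formula $\varphi(\alpha)$ (with first- and second-order parameters), $\exists X\forall\alpha(\alpha\in X\leftrightarrow\varphi(\alpha))$. (5) Arithmetic: $\alpha+0=\alpha$, $\alpha\times0=0$, $\alpha+\beta=\operatorname{ssup}\{\alpha+\gamma:\gamma<\beta\}$ for $\beta>0$, and $\alpha\times\beta=\operatorname{ssup}\{\alpha\times\gamma+\delta:\gamma<\beta,\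 \delta<\alpha\}$, where $\operatorname{ssup}$ is the least strict upper bound and $0$ is the least ordinal. A class is bounded if all its elements are below some ordinal. $\operatorname{Pair}$ is the Gödel pairing function (the order isomorphism onto the ordinals of the pairs of ordinals ordered first by maximum and then lexicographically), which is definable from $<,+,\times$. For a class $C$, $C_\alpha=\{\beta:\operatorname{Pair}(\alpha,\beta)\in C\}$ is its $\alpha$-th section. A sequence of classes $\langle P^\beta\rangle_{\beta<\alpha}$ is treated as a single class whose section at $\beta$ is $P^\beta$. $\operatorname{isRegEncoding}(E)$ ("$E$ is a regular encoding"): put $\operatorname{Ext}_E(\alpha)=\{\beta:\operatorname{Pair}(\beta,\alpha)\in E\}$. The two-sorted structure whose first sort is the ordinals with $<$, whose second sort consists of the classes $\operatorname{Ext}_E(\alpha)$, with $\in$ and with $e(\operatorname{Ext}_E(\alpha))=\alpha$, is well-defined and satisfies $\mathsf{SC}^{\mathrm{reg}}$ (expressed inside $\mathsf{OA}$ by a definable first-order truth predicate with class parameter $E$). Here $\mathsf{SC}^{\mathrm{reg}}$, with $x,y$ ranging over the second sort, has the axioms: $<$ is a strict linear order and each non-empty $x$ has a least element; the Replacement Schema $\forall\alpha(\forall\gamma<\alpha\,\exists!\delta\,\varphi\to\exists\beta\forall\gamma<\alpha\,\exists\delta<\beta\,\varphi)$ for first-order formulas of this two-sorted language; extensionality and boundedness of each $x$; Bounded Comprehension $\forall\alpha\exists x\forall\beta(\beta\in x\leftrightarrow\beta<\alpha\wedge\varphi(\beta))$ for first-order formulas of this language; $e$ is a bijection from the second sort to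 the ordinals; $\alpha\in x\to\alpha<e(x)$; existence of a nonzero limit ordinal; and Regularity: $\sup(x)<\sup(y)\to e(x)<e(y)$. $\mathsf{MU}$ (Maximality of the Universe of Sets): for every bounded class $g$ there is a class $E$ with $\operatorname{isRegEncoding}(E)$ and $\exists\alpha\forall\beta(\beta\in g\leftrightarrow\operatorname{Pair}(\beta,\alpha)\in E)$. $\mathsf{TDC}$ (Transfinite Dependent Choice), for every formula $\varphi$ (with parameters): suppose that for every ordinal $\alpha$ and every $\alpha$-sequence of classes $\langle P^\beta\rangle_{\beta<\alpha}$, there exists a class $P^\alpha$ with $\varphi(\alpha,P^\alpha,\langle P^\beta\rangle_{\beta<\alpha})$ if and only if for every $\beta<\alpha$ we have $\varphi(\beta,P^\beta,\langle P^\gamma\rangle_{\gamma<\beta})$. Then there exists a class $P$ such that for every $\alpha$, $\varphi(\alpha,P_\alpha,\langle P_\beta\rangle_{\beta<\alpha})$. A hyperclass is given by a formula (possibly with parameters) with one free class variable; its elements are the classes satisfying it. It is uniformly bounded if for some ordinal $\alpha$ all its elements are bounded by $\alpha$. A class $C$ encodes a hyperclass if for every non-empty element $D$ of the hyperclass there is exactly one ordinal $\alpha$ with $C_\alpha=D$. $\mathsf{UE}$ (Uniform Encodability) is the schema: every uniformly bounded hyperclass is encoded by a single bounded class. *)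

theory Defs
  imports Main
begin

section \<open>Monadic second-order syntax and provability\<close>

text \<open>
  Two-sorted de Bruijn syntax. Ordinal variables and class variables have separate index
  spaces: \<open>All\<close> binds ordinal index 0, \<open>AllC\<close> binds class index 0. The only class terms are
  class variables, represented by their index.
\<close>

datatype tm = Var nat | Add tm tm | Mul tm tm

datatype fm =
    Less tm tm
  | Eq tm tm
  | Mem tm nat
  | EqC nat nat
  | Falsum
  | Imp fm fm
  | All fm
  | AllC fm

primrec tsubst :: "(nat \<Rightarrow> tm) \<Rightarrow> tm \<Rightarrow> tm" where
  "tsubst \<sigma> (Var n) = \<sigma> n"
| "tsubst \<sigma> (Add s t) = Add (tsubst \<sigma> s) (tsubst \<sigma> t)"
| "tsubst \<sigma> (Mul s t) = Mul (tsubst \<sigma> s) (tsubst \<sigma> t)"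

definition lift_o :: "(nat \<Rightarrow> tm) \<Rightarrow> nat \<Rightarrow> tm" where
  "lift_o \<sigma> = case_nat (Var 0) (\<lambda>n. tsubst (\<lambda>k. Var (Suc k)) (\<sigma> n))"

definition lift_c :: "(nat \<Rightarrow> nat) \<Rightarrow> nat \<Rightarrow> nat" where
  "lift_c \<tau> = case_nat 0 (\<lambda>n. Suc (\<tau> n))"

text \<open>Simultaneous capture-avoiding substitution: \<open>\<sigma>\<close> for ordinal variables, \<open>\<tau>\<close> for class
  variables.\<close>

primrec fsubst :: "(nat \<Rightarrow> tm) \<Rightarrow> (nat \<Rightarrow> nat) \<Rightarrow> fm \<Rightarrow> fm" where
  "fsubst \<sigma> \<tau> (Less s t) = Less (tsubst \<sigma> s) (tsubst \<sigma> t)"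
| "fsubst \<sigma> \<tau> (Eq s t) = Eq (tsubst \<sigma> s) (tsubst \<sigma> t)"
| "fsubst \<sigma> \<tau> (Mem t X) = Mem (tsubst \<sigma> t) (\<tau> X)"
| "fsubst \<sigma> \<tau> (EqC X Y) = EqC (\<tau> X) (\<tau> Y)"
| "fsubst \<sigma> \<tau> Falsum = Falsum"
| "fsubst \<sigma> \<tau> (Imp \<phi> \<psi>) = Imp (fsubst \<sigma> \<tau> \<phi>) (fsubst \<sigma> \<tau> \<psi>)"
| "fsubst \<sigma> \<tau> (All \<phi>) = All (fsubst (lift_o \<sigma>) \<tau> \<phi>)"
| "fsubst \<sigma> \<tau> (AllC \<phi>) = AllC (fsubst \<sigma> (lift_c \<tau>) \<phi>)"

definition shift_o :: "fm \<Rightarrow> fm" where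
  "shift_o = fsubst (\<lambda>n. Var (Suc n)) (\<lambda>n. n)"

definition shift_c :: "fm \<Rightarrow> fm" where
  "shift_c = fsubst Var Suc"

definition inst_o :: "tm \<Rightarrow> fm \<Rightarrow> fm" where
  "inst_o t = fsubst (case_nat t Var) (\<lambda>n. n)"

definition inst_c :: "nat \<Rightarrow> fm \<Rightarrow> fm" where
  "inst_c Y = fsubst Var (case_nat Y (\<lambda>n. n))"

text \<open>Classical natural deduction with equality. In \<open>allI\<close> and \<open>allCI\<close> the eigenvariable is
  index 0, and shifting the context makes it fresh.\<close>

inductive proves :: "fm set \<Rightarrow> fm \<Rightarrow> bool" (infix "\<turnstile>" 50) where
  assm: "\<phi> \<in> \<Gamma> \<Longrightarrow> \<Gamma> \<turnstile> \<phi>"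
| impI: "insert \<phi> \<Gamma> \<turnstile> \<psi> \<Longrightarrow> \<Gamma> \<turnstile> Imp \<phi> \<psi>"
| impE: "\<Gamma> \<turnstile> Imp \<phi> \<psi> \<Longrightarrow> \<Gamma> \<turnstile> \<phi> \<Longrightarrow> \<Gamma> \<turnstile> \<psi>"
| contr: "insert (Imp \<phi> Falsum) \<Gamma> \<turnstile> Falsum \<Longrightarrow> \<Gamma> \<turnstile> \<phi>"
| allI: "shift_o ` \<Gamma> \<turnstile> \<phi> \<Longrightarrow> \<Gamma> \<turnstile> All \<phi>"
| allE: "\<Gamma> \<turnstile> All \<phi> \<Longrightarrow> \<Gamma> \<turnstile> inst_o t \<phi>"
| allCI: "shift_c ` \<Gamma> \<turnstile> \<phi> \<Longrightarrow> \<Gamma> \<turnstile> AllC \<phi>"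
| allCE: "\<Gamma> \<turnstile> AllC \<phi> \<Longrightarrow> \<Gamma> \<turnstile> inst_c Y \<phi>"
| eq_refl: "\<Gamma> \<turnstile> Eq t t"
| eq_subst: "\<Gamma> \<turnstile> Eq s t \<Longrightarrow> \<Gamma> \<turnstile> inst_o s \<phi> \<Longrightarrow> \<Gamma> \<turnstile> inst_o t \<phi>"
| eqC_refl: "\<Gamma> \<turnstile> EqC X X"
| eqC_subst: "\<Gamma> \<turnstile> EqC X Y \<Longrightarrow> \<Gamma> \<turnstile> inst_c X \<phi> \<Longrightarrow> \<Gamma> \<turnstile> inst_c Y \<phi>"

primrec tm_below :: "nat \<Rightarrow> tm \<Rightarrow> bool" where
  "tm_below n (Var k) \<longleftrightarrow> k < n"
| "tm_below n (Add s t) \<longleftrightarrow> tm_below n s \<and> tm_below n t"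
| "tm_below n (Mul s t) \<longleftrightarrow> tm_below n s \<and> tm_below n t"

text \<open>\<open>fm_below n m \<phi>\<close>: the free ordinal (class) variables of \<open>\<phi>\<close> have indices \<open>< n\<close> (\<open>< m\<close>).\<close>

primrec fm_below :: "nat \<Rightarrow> nat \<Rightarrow> fm \<Rightarrow> bool" where
  "fm_below n m (Less s t) \<longleftrightarrow> tm_below n s \<and> tm_below n t"
| "fm_below n m (Eq s t) \<longleftrightarrow> tm_below n s \<and> tm_below n t"
| "fm_below n m (Mem t X) \<longleftrightarrow> tm_below n t \<and> X < m"
| "fm_below n m (EqC X Y) \<longleftrightarrow> X < m \<and> Y < m"
| "fm_below n m Falsum \<longleftrightarrow> True"
| "fm_below n m (Imp \<phi> \<psi>) \<longleftrightarrow> fm_below n m \<phi> \<and> fm_below n m \<psi>"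
| "fm_below n m (All \<phi>) \<longleftrightarrow> fm_below (Suc n) m \<phi>"
| "fm_below n m (AllC \<phi>) \<longleftrightarrow> fm_below n (Suc m) \<phi>"


section \<open>Writing formulas with named binders\<close>

text \<open>
  To write concrete formulas readably, a formula is presented as a function of the numbers \<open>d\<close>
  and \<open>e\<close> of ordinal and class quantifiers above it. A variable bound at depth \<open>d\<close> (a de Bruijn
  level) is the function that, used at depth \<open>d'\<close>, returns the index \<open>d' - Suc d\<close>. Bound variables
  are thereby HOL variables and capture cannot occur. A sentence is obtained by evaluation at
  depth \<open>0 0\<close>.
\<close>

type_synonym otm = "nat \<Rightarrow> tm"
type_synonym ctm = "nat \<Rightarrow> nat"
type_synonym form = "nat \<Rightarrow> nat \<Rightarrow> fm"

definition add_o :: "otm \<Rightarrow> otm \<Rightarrow> otm" (infixl "\<^bold>+" 65) where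
  "x \<^bold>+ y = (\<lambda>d. Add (x d) (y d))"

definition mul_o :: "otm \<Rightarrow> otm \<Rightarrow> otm" (infixl "\<^bold>\<times>" 70) where
  "x \<^bold>\<times> y = (\<lambda>d. Mul (x d) (y d))"

definition less_f :: "otm \<Rightarrow> otm \<Rightarrow> form" (infix "\<^bold><" 50) where
  "x \<^bold>< y = (\<lambda>d e. Less (x d) (y d))"

definition eq_f :: "otm \<Rightarrow> otm \<Rightarrow> form" (infix "\<^bold>=" 50) where
  "x \<^bold>= y = (\<lambda>d e. Eq (x d) (y d))"

definition mem_f :: "otm \<Rightarrow> ctm \<Rightarrow> form" (infix "\<^bold>\<in>" 50) where
  "x \<^bold>\<in> X = (\<lambda>d e. Mem (x d) (X e))"

definition eqC_f :: "ctm \<Rightarrow> ctm \<Rightarrow> form" (infix "\<^bold>=\<^sub>c" 50) where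
  "X \<^bold>=\<^sub>c Y = (\<lambda>d e. EqC (X e) (Y e))"

definition false_f :: form ("\<^bold>\<bottom>") where
  "\<^bold>\<bottom> = (\<lambda>d e. Falsum)"

definition imp_f :: "form \<Rightarrow> form \<Rightarrow> form" (infixr "\<^bold>\<longrightarrow>" 25) where
  "(F \<^bold>\<longrightarrow> G) = (\<lambda>d e. Imp (F d e) (G d e))"

definition all_f :: "(otm \<Rightarrow> form) \<Rightarrow> form" (binder "\<^bold>\<forall>" 10) where
  "all_f F = (\<lambda>d e. All (F (\<lambda>d'. Var (d' - Suc d)) (Suc d) e))"

definition allC_f :: "(ctm \<Rightarrow> form) \<Rightarrow> form" (binder "\<^bold>\<forall>\<^sub>c" 10) where
  "allC_f F = (\<lambda>d e. AllC (F (\<lambda>e'. e' - Suc e) d (Suc e)))"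

definition not_f :: "form \<Rightarrow> form" ("\<^bold>\<not> _" [40] 40) where
  "(\<^bold>\<not> F) = (F \<^bold>\<longrightarrow> \<^bold>\<bottom>)"

definition and_f :: "form \<Rightarrow> form \<Rightarrow> form" (infixr "\<^bold>\<and>" 35) where
  "(F \<^bold>\<and> G) = (\<^bold>\<not> (F \<^bold>\<longrightarrow> \<^bold>\<not> G))"

definition or_f :: "form \<Rightarrow> form \<Rightarrow> form" (infixr "\<^bold>\<or>" 30) where
  "(F \<^bold>\<or> G) = ((\<^bold>\<not> F) \<^bold>\<longrightarrow> G)"

definition iff_f :: "form \<Rightarrow> form \<Rightarrow> form" (infixr "\<^bold>\<longleftrightarrow>" 25) where
  "(F \<^bold>\<longleftrightarrow> G) = ((F \<^bold>\<longrightarrow> G) \<^bold>\<and> (G \<^bold>\<longrightarrow> F))"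

definition ex_f :: "(otm \<Rightarrow> form) \<Rightarrow> form" (binder "\<^bold>\<exists>" 10) where
  "ex_f F = (\<^bold>\<not> (\<^bold>\<forall>x. \<^bold>\<not> F x))"

definition exC_f :: "(ctm \<Rightarrow> form) \<Rightarrow> form" (binder "\<^bold>\<exists>\<^sub>c" 10) where
  "exC_f F = (\<^bold>\<not> (\<^bold>\<forall>\<^sub>cX. \<^bold>\<not> F X))"

definition ex1_f :: "(otm \<Rightarrow> form) \<Rightarrow> form" (binder "\<^bold>\<exists>\<^sub>1" 10) where
  "ex1_f F = (\<^bold>\<exists>x. F x \<^bold>\<and> (\<^bold>\<forall>y. F y \<^bold>\<longrightarrow> y \<^bold>= x))"

text \<open>
  Schemata. A schematic formula \<open>\<phi>\<close> is an arbitrary \<open>fm\<close>. In \<open>app \<phi> xs Xs\<close> its first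
  \<open>length xs\<close> ordinal variables and \<open>length Xs\<close> class variables are replaced by the given terms;
  its remaining variables are parameters, namely the outermost quantifiers supplied by
  \<open>closure p q\<close>. This is only used when all parameters are covered by the closure, i.e. when
  \<open>fm_below (length xs + p) (length Xs + q) \<phi>\<close>.
\<close>

definition app :: "fm \<Rightarrow> otm list \<Rightarrow> ctm list \<Rightarrow> form" where
  "app \<phi> xs Xs = (\<lambda>d e. fsubst
     (\<lambda>i. if i < length xs then (xs ! i) d else Var (d - Suc (i - length xs)))
     (\<lambda>j. if j < length Xs then (Xs ! j) e else e - Suc (j - length Xs)) \<phi>)"

definition closure :: "nat \<Rightarrow> nat \<Rightarrow> form \<Rightarrow> fm" where
  "closure p q F = (All ^^ p) ((AllC ^^ q) (F p q))"

definition sentence :: "form \<Rightarrow> fm" where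
  "sentence F = closure 0 0 F"


section \<open>The theory OA\<close>

definition le_f :: "otm \<Rightarrow> otm \<Rightarrow> form" (infix "\<^bold>\<le>" 50) where
  "x \<^bold>\<le> y = (x \<^bold>< y \<^bold>\<or> x \<^bold>= y)"

definition strict_linear :: form where
  "strict_linear =
     ((\<^bold>\<forall>x. \<^bold>\<not> x \<^bold>< x) \<^bold>\<and>
      (\<^bold>\<forall>x. \<^bold>\<forall>y. \<^bold>\<forall>z. x \<^bold>< y \<^bold>\<and> y \<^bold>< z \<^bold>\<longrightarrow> x \<^bold>< z) \<^bold>\<and>
      (\<^bold>\<forall>x. \<^bold>\<forall>y. x \<^bold>< y \<^bold>\<or> x \<^bold>= y \<^bold>\<or> y \<^bold>< x))"

definition limit_exists :: form where
  "limit_exists = (\<^bold>\<exists>\<alpha>. (\<^bold>\<exists>\<beta>. \<beta> \<^bold>< \<alpha>) \<^bold>\<and> (\<^bold>\<forall>\<beta>. \<beta> \<^bold>< \<alpha> \<^bold>\<longrightarrow> (\<^bold>\<exists>\<gamma>. \<gamma> \<^bold>< \<alpha> \<^bold>\<and> \<beta> \<^bold>< \<gamma>)))"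

text \<open>Collections of ordinals given by a formula with one free ordinal variable:\<close>

definition has_least :: "(otm \<Rightarrow> form) \<Rightarrow> form" where
  "has_least P = ((\<^bold>\<exists>\<alpha>. P \<alpha>) \<^bold>\<longrightarrow> (\<^bold>\<exists>\<alpha>. P \<alpha> \<^bold>\<and> (\<^bold>\<forall>\<beta>. P \<beta> \<^bold>\<longrightarrow> \<alpha> \<^bold>\<le> \<beta>)))"

definition is_ssup :: "(otm \<Rightarrow> form) \<Rightarrow> otm \<Rightarrow> form" where
  "is_ssup P \<sigma> = ((\<^bold>\<forall>\<alpha>. P \<alpha> \<^bold>\<longrightarrow> \<alpha> \<^bold>< \<sigma>) \<^bold>\<and> (\<^bold>\<forall>\<tau>. (\<^bold>\<forall>\<alpha>. P \<alpha> \<^bold>\<longrightarrow> \<alpha> \<^bold>< \<tau>) \<^bold>\<longrightarrow> \<sigma> \<^bold>\<le> \<tau>))"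

definition is_sup :: "(otm \<Rightarrow> form) \<Rightarrow> otm \<Rightarrow> form" where
  "is_sup P \<sigma> = ((\<^bold>\<forall>\<alpha>. P \<alpha> \<^bold>\<longrightarrow> \<alpha> \<^bold>\<le> \<sigma>) \<^bold>\<and> (\<^bold>\<forall>\<tau>. (\<^bold>\<forall>\<alpha>. P \<alpha> \<^bold>\<longrightarrow> \<alpha> \<^bold>\<le> \<tau>) \<^bold>\<longrightarrow> \<sigma> \<^bold>\<le> \<tau>))"

definition is_zero :: "otm \<Rightarrow> form" where
  "is_zero x = (\<^bold>\<forall>y. \<^bold>\<not> y \<^bold>< x)"

definition replacement_f :: "(otm \<Rightarrow> otm \<Rightarrow> form) \<Rightarrow> form" where
  "replacement_f \<Phi> =
     (\<^bold>\<forall>\<alpha>. (\<^bold>\<forall>\<gamma>. \<gamma> \<^bold>< \<alpha> \<^bold>\<longrightarrow> (\<^bold>\<exists>\<^sub>1\<delta>. \<Phi> \<gamma> \<delta>)) \<^bold>\<longrightarrow>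
           (\<^bold>\<exists>\<beta>. \<^bold>\<forall>\<gamma>. \<gamma> \<^bold>< \<alpha> \<^bold>\<longrightarrow> (\<^bold>\<exists>\<delta>. \<delta> \<^bold>< \<beta> \<^bold>\<and> \<Phi> \<gamma> \<delta>)))"

definition order_axioms :: "fm set" where
  "order_axioms =
     {sentence strict_linear, sentence limit_exists,
      sentence (\<^bold>\<forall>\<^sub>cX. has_least (\<lambda>\<alpha>. \<alpha> \<^bold>\<in> X))}"

definition replacement_axioms :: "fm set" where
  "replacement_axioms =
     {closure p q (replacement_f (\<lambda>\<gamma> \<delta>. app \<phi> [\<gamma>, \<delta>] [])) | p q \<phi>. fm_below (2 + p) q \<phi>}"

definition extensionality_axiom :: fm where
  "extensionality_axiom =
     sentence (\<^bold>\<forall>\<^sub>cX. \<^bold>\<forall>\<^sub>cY. (\<^bold>\<forall>\<alpha>. \<alpha> \<^bold>\<in> X \<^bold>\<longleftrightarrow> \<alpha> \<^bold>\<in> Y) \<^bold>\<longrightarrow> X \<^bold>=\<^sub>c Y)"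

definition comprehension_axioms :: "fm set" where
  "comprehension_axioms =
     {closure p q (\<^bold>\<exists>\<^sub>cX. \<^bold>\<forall>\<alpha>. \<alpha> \<^bold>\<in> X \<^bold>\<longleftrightarrow> app \<phi> [\<alpha>] []) | p q \<phi>. fm_below (1 + p) q \<phi>}"

definition arithmetic_axioms :: "fm set" where
  "arithmetic_axioms =
     {sentence (\<^bold>\<forall>\<alpha>. \<^bold>\<forall>z. is_zero z \<^bold>\<longrightarrow> \<alpha> \<^bold>+ z \<^bold>= \<alpha>),
      sentence (\<^bold>\<forall>\<alpha>. \<^bold>\<forall>z. is_zero z \<^bold>\<longrightarrow> \<alpha> \<^bold>\<times> z \<^bold>= z),
      sentence (\<^bold>\<forall>\<alpha>. \<^bold>\<forall>\<beta>. (\<^bold>\<not> is_zero \<beta>) \<^bold>\<longrightarrow>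
        is_ssup (\<lambda>\<xi>. \<^bold>\<exists>\<gamma>. \<gamma> \<^bold>< \<beta> \<^bold>\<and> \<xi> \<^bold>= \<alpha> \<^bold>+ \<gamma>) (\<alpha> \<^bold>+ \<beta>)),
      sentence (\<^bold>\<forall>\<alpha>. \<^bold>\<forall>\<beta>.
        is_ssup (\<lambda>\<xi>. \<^bold>\<exists>\<gamma>. \<^bold>\<exists>\<delta>. \<gamma> \<^bold>< \<beta> \<^bold>\<and> \<delta> \<^bold>< \<alpha> \<^bold>\<and> \<xi> \<^bold>= \<alpha> \<^bold>\<times> \<gamma> \<^bold>+ \<delta>) (\<alpha> \<^bold>\<times> \<beta>))}"

definition OA :: "fm set" where
  "OA = order_axioms \<union> replacement_axioms \<union> {extensionality_axiom} \<union>
        comprehension_axioms \<union> arithmetic_axioms"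


section \<open>Goedel pairing, sections\<close>

definition is_max :: "otm \<Rightarrow> otm \<Rightarrow> otm \<Rightarrow> form" where
  "is_max a b m = ((b \<^bold>\<le> a \<^bold>\<and> m \<^bold>= a) \<^bold>\<or> (a \<^bold>\<le> b \<^bold>\<and> m \<^bold>= b))"

definition goedel_less :: "otm \<Rightarrow> otm \<Rightarrow> otm \<Rightarrow> otm \<Rightarrow> form" where
  "goedel_less a b a' b' =
     (\<^bold>\<exists>m. \<^bold>\<exists>m'. is_max a b m \<^bold>\<and> is_max a' b' m' \<^bold>\<and>
        (m \<^bold>< m' \<^bold>\<or> (m \<^bold>= m' \<^bold>\<and> (a \<^bold>< a' \<^bold>\<or> (a \<^bold>= a' \<^bold>\<and> b \<^bold>< b')))))"

text \<open>
  The order isomorphism is a ternary relation between ordinals. To speak about it as a class,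
  triples are coded by the term \<open>aux\<close>, which is injective by ordinal arithmetic
  (\<open>s = a + b\<close> is determined by \<open>s \<times> s \<le> aux a b < (s + 1) \<times> (s + 1)\<close>). It serves only to define
  the Goedel pairing.
\<close>

definition aux :: "otm \<Rightarrow> otm \<Rightarrow> otm" where
  "aux a b = (a \<^bold>+ b) \<^bold>\<times> (a \<^bold>+ b) \<^bold>+ a"

definition aux_mem :: "otm \<Rightarrow> otm \<Rightarrow> otm \<Rightarrow> ctm \<Rightarrow> form" where
  "aux_mem a b c R = (aux (aux a b) c \<^bold>\<in> R)"

definition is_goedel_iso :: "ctm \<Rightarrow> form" where
  "is_goedel_iso R =
     ((\<^bold>\<forall>a. \<^bold>\<forall>b. \<^bold>\<exists>\<^sub>1c. aux_mem a b c R) \<^bold>\<and>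
      (\<^bold>\<forall>c. \<^bold>\<exists>a. \<^bold>\<exists>b. aux_mem a b c R) \<^bold>\<and>
      (\<^bold>\<forall>a. \<^bold>\<forall>b. \<^bold>\<forall>c. \<^bold>\<forall>a'. \<^bold>\<forall>b'. \<^bold>\<forall>c'. aux_mem a b c R \<^bold>\<and> aux_mem a' b' c' R \<^bold>\<longrightarrow>
         (goedel_less a b a' b' \<^bold>\<longleftrightarrow> c \<^bold>< c')))"

text \<open>\<open>is_pair a b c\<close> expresses \<open>c = Pair(a, b)\<close>.\<close>

definition is_pair :: "otm \<Rightarrow> otm \<Rightarrow> otm \<Rightarrow> form" where
  "is_pair a b c = (\<^bold>\<exists>\<^sub>cR. is_goedel_iso R \<^bold>\<and> aux_mem a b c R)"

definition pair_mem :: "otm \<Rightarrow> otm \<Rightarrow> ctm \<Rightarrow> form" where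
  "pair_mem a b C = (\<^bold>\<exists>c. is_pair a b c \<^bold>\<and> c \<^bold>\<in> C)"

definition triple_mem :: "otm \<Rightarrow> otm \<Rightarrow> otm \<Rightarrow> ctm \<Rightarrow> form" where
  "triple_mem a b c C = (\<^bold>\<exists>p. is_pair b c p \<^bold>\<and> pair_mem a p C)"

definition bounded_by :: "ctm \<Rightarrow> otm \<Rightarrow> form" where
  "bounded_by X \<alpha> = (\<^bold>\<forall>\<beta>. \<beta> \<^bold>\<in> X \<^bold>\<longrightarrow> \<beta> \<^bold>< \<alpha>)"

definition bounded_f :: "ctm \<Rightarrow> form" where
  "bounded_f X = (\<^bold>\<exists>\<alpha>. bounded_by X \<alpha>)"

definition is_section :: "ctm \<Rightarrow> otm \<Rightarrow> ctm \<Rightarrow> form" where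
  "is_section C \<alpha> D = (\<^bold>\<forall>\<beta>. \<beta> \<^bold>\<in> D \<^bold>\<longleftrightarrow> pair_mem \<alpha> \<beta> C)"

text \<open>An \<open>\<alpha>\<close>-sequence of classes is a class all of whose elements lie in its sections below \<open>\<alpha>\<close>.\<close>

definition is_sequence :: "ctm \<Rightarrow> otm \<Rightarrow> form" where
  "is_sequence Q \<alpha> = (\<^bold>\<forall>z. z \<^bold>\<in> Q \<^bold>\<longrightarrow> (\<^bold>\<exists>\<beta>. \<^bold>\<exists>\<gamma>. \<beta> \<^bold>< \<alpha> \<^bold>\<and> is_pair \<beta> \<gamma> z))"

definition is_restriction :: "ctm \<Rightarrow> otm \<Rightarrow> ctm \<Rightarrow> form" where
  "is_restriction P \<alpha> Q =
     (\<^bold>\<forall>z. z \<^bold>\<in> Q \<^bold>\<longleftrightarrow> z \<^bold>\<in> P \<^bold>\<and> (\<^bold>\<exists>\<beta>. \<^bold>\<exists>\<gamma>. \<beta> \<^bold>< \<alpha> \<^bold>\<and> is_pair \<beta> \<gamma> z))"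


section \<open>Internal syntax of the language of SC\<close>

text \<open>
  The language of \<open>SC\<close> (symbols \<open><\<close>, \<open>\<in>\<close>, \<open>e\<close> and equality on both sorts) is coded by finite
  ordinals, again with separate de Bruijn indices for the two sorts of variables:
  terms \<open>v\<^sub>i \<mapsto> Pair(0, i)\<close> and \<open>e(x\<^sub>j) \<mapsto> Pair(1, j)\<close>;
  formulas \<open>u < v\<close>, \<open>u = v\<close>, \<open>u \<in> x\<^sub>j\<close>, \<open>x\<^sub>i = x\<^sub>j\<close>, negation, implication, quantification over
  ordinals and over the second sort, with tags 0 to 7 in this order.
\<close>

definition is_suc :: "otm \<Rightarrow> otm \<Rightarrow> form" where
  "is_suc x y = (x \<^bold>< y \<^bold>\<and> (\<^bold>\<forall>z. x \<^bold>< z \<^bold>\<longrightarrow> y \<^bold>\<le> z))"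

definition is_nat :: "otm \<Rightarrow> form" where
  "is_nat n = (\<^bold>\<forall>k. k \<^bold>\<le> n \<^bold>\<longrightarrow> is_zero k \<^bold>\<or> (\<^bold>\<exists>j. is_suc j k))"

primrec is_num :: "nat \<Rightarrow> otm \<Rightarrow> form" where
  "is_num 0 x = is_zero x"
| "is_num (Suc k) x = (\<^bold>\<exists>y. is_num k y \<^bold>\<and> is_suc y x)"

definition code1 :: "nat \<Rightarrow> otm \<Rightarrow> otm \<Rightarrow> form" where
  "code1 k a c = (\<^bold>\<exists>n. is_num k n \<^bold>\<and> is_pair n a c)"

definition code2 :: "nat \<Rightarrow> otm \<Rightarrow> otm \<Rightarrow> otm \<Rightarrow> form" where
  "code2 k a b c = (\<^bold>\<exists>p. is_pair a b p \<^bold>\<and> code1 k p c)"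

definition is_term :: "otm \<Rightarrow> form" where
  "is_term u = (\<^bold>\<exists>i. is_nat i \<^bold>\<and> (code1 0 i u \<^bold>\<or> code1 1 i u))"

definition is_atomic :: "otm \<Rightarrow> form" where
  "is_atomic c =
     ((\<^bold>\<exists>u. \<^bold>\<exists>v. is_term u \<^bold>\<and> is_term v \<^bold>\<and> (code2 0 u v c \<^bold>\<or> code2 1 u v c)) \<^bold>\<or>
      (\<^bold>\<exists>u. \<^bold>\<exists>j. is_term u \<^bold>\<and> is_nat j \<^bold>\<and> code2 2 u j c) \<^bold>\<or>
      (\<^bold>\<exists>i. \<^bold>\<exists>j. is_nat i \<^bold>\<and> is_nat j \<^bold>\<and> code2 3 i j c))"

definition form_closed :: "ctm \<Rightarrow> form" where
  "form_closed F =
     ((\<^bold>\<forall>c. is_atomic c \<^bold>\<longrightarrow> c \<^bold>\<in> F) \<^bold>\<and>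
      (\<^bold>\<forall>a. \<^bold>\<forall>c. a \<^bold>\<in> F \<^bold>\<and> (code1 4 a c \<^bold>\<or> code1 6 a c \<^bold>\<or> code1 7 a c) \<^bold>\<longrightarrow> c \<^bold>\<in> F) \<^bold>\<and>
      (\<^bold>\<forall>a. \<^bold>\<forall>b. \<^bold>\<forall>c. a \<^bold>\<in> F \<^bold>\<and> b \<^bold>\<in> F \<^bold>\<and> code2 5 a b c \<^bold>\<longrightarrow> c \<^bold>\<in> F))"

definition is_form :: "otm \<Rightarrow> form" where
  "is_form c = (\<^bold>\<forall>\<^sub>cF. form_closed F \<^bold>\<longrightarrow> c \<^bold>\<in> F)"

text \<open>
  Assignments. As \<open>Pair\<close> is a bijection, every ordinal \<open>s\<close> codes an assignment: the variable 0 has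
  as value the first component of \<open>s\<close>, and the variables \<open>n + 1\<close> are assigned according to the second
  component of \<open>s\<close>. So \<open>Pair(a, s)\<close> is \<open>s\<close> with \<open>a\<close> pushed in front, and every finite sequence of
  ordinals occurs as the beginning of some assignment.
\<close>

definition is_lookup :: "ctm \<Rightarrow> form" where
  "is_lookup L =
     ((\<^bold>\<forall>n. \<^bold>\<forall>s. \<^bold>\<forall>a. is_zero n \<^bold>\<longrightarrow> (triple_mem n s a L \<^bold>\<longleftrightarrow> (\<^bold>\<exists>r. is_pair a r s))) \<^bold>\<and>
      (\<^bold>\<forall>m. \<^bold>\<forall>n. \<^bold>\<forall>s. \<^bold>\<forall>a. is_nat m \<^bold>\<and> is_suc m n \<^bold>\<longrightarrow>
         (triple_mem n s a L \<^bold>\<longleftrightarrow> (\<^bold>\<exists>b. \<^bold>\<exists>r. is_pair b r s \<^bold>\<and> triple_mem m r a L))))"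

definition var_val :: "otm \<Rightarrow> otm \<Rightarrow> otm \<Rightarrow> form" where
  "var_val n s a = (\<^bold>\<exists>\<^sub>cL. is_lookup L \<^bold>\<and> triple_mem n s a L)"


section \<open>Regular encodings\<close>

text \<open>
  An element \<open>Ext\<^sub>E(\<xi>)\<close> of the second sort is referred to by the ordinal \<open>\<xi>\<close>, so quantification
  over the second sort is quantification over \<open>\<xi>\<close>, and \<open>e(Ext\<^sub>E(\<xi>)) = \<xi>\<close>. \<open>in_ext E \<beta> \<xi>\<close> expresses
  \<open>\<beta> \<in> Ext\<^sub>E(\<xi>)\<close>.
\<close>

definition in_ext :: "ctm \<Rightarrow> otm \<Rightarrow> otm \<Rightarrow> form" where
  "in_ext E \<beta> \<xi> = pair_mem \<beta> \<xi> E"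

definition same_ext :: "ctm \<Rightarrow> otm \<Rightarrow> otm \<Rightarrow> form" where
  "same_ext E \<xi> \<eta> = (\<^bold>\<forall>\<beta>. in_ext E \<beta> \<xi> \<^bold>\<longleftrightarrow> in_ext E \<beta> \<eta>)"

text \<open>In what follows \<open>s\<close> is an assignment for the ordinal variables and \<open>t\<close> one for the variables
  of the second sort.\<close>

definition term_val :: "otm \<Rightarrow> otm \<Rightarrow> otm \<Rightarrow> otm \<Rightarrow> form" where
  "term_val u s t a =
     (\<^bold>\<exists>i. is_nat i \<^bold>\<and> ((code1 0 i u \<^bold>\<and> var_val i s a) \<^bold>\<or> (code1 1 i u \<^bold>\<and> var_val i t a)))"

text \<open>\<open>is_satisfaction E S\<close>: the class \<open>S\<close> of triples (formula, \<open>s\<close>, \<open>t\<close>) obeys Tarski's clauses for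
  the structure given by \<open>E\<close>.\<close>

definition is_satisfaction :: "ctm \<Rightarrow> ctm \<Rightarrow> form" where
  "is_satisfaction E S = (\<^bold>\<forall>s. \<^bold>\<forall>t.
     (\<^bold>\<forall>u. \<^bold>\<forall>v. \<^bold>\<forall>c. is_term u \<^bold>\<and> is_term v \<^bold>\<and> code2 0 u v c \<^bold>\<longrightarrow>
        (triple_mem c s t S \<^bold>\<longleftrightarrow> (\<^bold>\<exists>a. \<^bold>\<exists>b. term_val u s t a \<^bold>\<and> term_val v s t b \<^bold>\<and> a \<^bold>< b))) \<^bold>\<and>
     (\<^bold>\<forall>u. \<^bold>\<forall>v. \<^bold>\<forall>c. is_term u \<^bold>\<and> is_term v \<^bold>\<and> code2 1 u v c \<^bold>\<longrightarrow>
        (triple_mem c s t S \<^bold>\<longleftrightarrow> (\<^bold>\<exists>a. \<^bold>\<exists>b. term_val u s t a \<^bold>\<and> term_val v s t b \<^bold>\<and> a \<^bold>= b))) \<^bold>\<and>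
     (\<^bold>\<forall>u. \<^bold>\<forall>j. \<^bold>\<forall>c. is_term u \<^bold>\<and> is_nat j \<^bold>\<and> code2 2 u j c \<^bold>\<longrightarrow>
        (triple_mem c s t S \<^bold>\<longleftrightarrow> (\<^bold>\<exists>a. \<^bold>\<exists>\<xi>. term_val u s t a \<^bold>\<and> var_val j t \<xi> \<^bold>\<and> in_ext E a \<xi>))) \<^bold>\<and>
     (\<^bold>\<forall>i. \<^bold>\<forall>j. \<^bold>\<forall>c. is_nat i \<^bold>\<and> is_nat j \<^bold>\<and> code2 3 i j c \<^bold>\<longrightarrow>
        (triple_mem c s t S \<^bold>\<longleftrightarrow> (\<^bold>\<exists>\<xi>. \<^bold>\<exists>\<eta>. var_val i t \<xi> \<^bold>\<and> var_val j t \<eta> \<^bold>\<and> same_ext E \<xi> \<eta>))) \<^bold>\<and>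
     (\<^bold>\<forall>a. \<^bold>\<forall>c. is_form a \<^bold>\<and> code1 4 a c \<^bold>\<longrightarrow>
        (triple_mem c s t S \<^bold>\<longleftrightarrow> (\<^bold>\<not> triple_mem a s t S))) \<^bold>\<and>
     (\<^bold>\<forall>a. \<^bold>\<forall>b. \<^bold>\<forall>c. is_form a \<^bold>\<and> is_form b \<^bold>\<and> code2 5 a b c \<^bold>\<longrightarrow>
        (triple_mem c s t S \<^bold>\<longleftrightarrow> (triple_mem a s t S \<^bold>\<longrightarrow> triple_mem b s t S))) \<^bold>\<and>
     (\<^bold>\<forall>a. \<^bold>\<forall>c. is_form a \<^bold>\<and> code1 6 a c \<^bold>\<longrightarrow>
        (triple_mem c s t S \<^bold>\<longleftrightarrow> (\<^bold>\<forall>\<alpha>. \<^bold>\<forall>s'. is_pair \<alpha> s s' \<^bold>\<longrightarrow> triple_mem a s' t S))) \<^bold>\<and>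
     (\<^bold>\<forall>a. \<^bold>\<forall>c. is_form a \<^bold>\<and> code1 7 a c \<^bold>\<longrightarrow>
        (triple_mem c s t S \<^bold>\<longleftrightarrow> (\<^bold>\<forall>\<xi>. \<^bold>\<forall>t'. is_pair \<xi> t t' \<^bold>\<longrightarrow> triple_mem a s t' S))))"

definition truth :: "ctm \<Rightarrow> otm \<Rightarrow> otm \<Rightarrow> otm \<Rightarrow> form" where
  "truth E c s t = (\<^bold>\<exists>\<^sub>cS. is_satisfaction E S \<^bold>\<and> triple_mem c s t S)"

text \<open>Truth of \<open>c\<close> when the ordinals \<open>\<alpha>\<close>, or \<open>\<alpha>\<close> and \<open>\<beta>\<close>, are assigned to the first ordinal
  variables and \<open>s\<close> to the remaining ones.\<close>

definition truth1 :: "ctm \<Rightarrow> otm \<Rightarrow> otm \<Rightarrow> otm \<Rightarrow> otm \<Rightarrow> form" where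
  "truth1 E c \<alpha> s t = (\<^bold>\<exists>s'. is_pair \<alpha> s s' \<^bold>\<and> truth E c s' t)"

definition truth2 :: "ctm \<Rightarrow> otm \<Rightarrow> otm \<Rightarrow> otm \<Rightarrow> otm \<Rightarrow> otm \<Rightarrow> form" where
  "truth2 E c \<alpha> \<beta> s t = (\<^bold>\<exists>s'. is_pair \<beta> s s' \<^bold>\<and> truth1 E c \<alpha> s' t)"

text \<open>
  The first conjunct says that the structure is well-defined, i.e. that \<open>e\<close> is a function; in view of
  it, Extensionality holds under this reading of the second sort. The others are, in order: the order
  axioms; Replacement for all internal formulas and all parameters; boundedness; Bounded
  Comprehension for all internal formulas and all parameters; \<open>e\<close> is a bijection onto the ordinals
  (trivial here, as \<open>e(Ext\<^sub>E(\<xi>)) = \<xi>\<close>); \<open>\<alpha> \<in> x \<longrightarrow> \<alpha> < e(x)\<close>; existence of a limit; Regularity. The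
  axioms are written as their Tarskian truth conditions in the structure, where only the schematic
  formula, which may be a nonstandard one, needs the truth predicate.
\<close>

definition is_reg_encoding :: "ctm \<Rightarrow> form" where
  "is_reg_encoding E =
     ((\<^bold>\<forall>\<xi>. \<^bold>\<forall>\<eta>. same_ext E \<xi> \<eta> \<^bold>\<longrightarrow> \<xi> \<^bold>= \<eta>) \<^bold>\<and>
      strict_linear \<^bold>\<and>
      (\<^bold>\<forall>\<xi>. has_least (\<lambda>\<alpha>. in_ext E \<alpha> \<xi>)) \<^bold>\<and>
      (\<^bold>\<forall>c. \<^bold>\<forall>s. \<^bold>\<forall>t. is_form c \<^bold>\<longrightarrow> replacement_f (\<lambda>\<gamma> \<delta>. truth2 E c \<gamma> \<delta> s t)) \<^bold>\<and>
      (\<^bold>\<forall>\<xi>. \<^bold>\<exists>\<alpha>. \<^bold>\<forall>\<beta>. in_ext E \<beta> \<xi> \<^bold>\<longrightarrow> \<beta> \<^bold>< \<alpha>) \<^bold>\<and>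
      (\<^bold>\<forall>c. \<^bold>\<forall>s. \<^bold>\<forall>t. is_form c \<^bold>\<longrightarrow>
         (\<^bold>\<forall>\<alpha>. \<^bold>\<exists>\<xi>. \<^bold>\<forall>\<beta>. in_ext E \<beta> \<xi> \<^bold>\<longleftrightarrow> \<beta> \<^bold>< \<alpha> \<^bold>\<and> truth1 E c \<beta> s t)) \<^bold>\<and>
      (\<^bold>\<forall>\<alpha>. \<^bold>\<exists>\<^sub>1\<xi>. \<xi> \<^bold>= \<alpha>) \<^bold>\<and>
      (\<^bold>\<forall>\<xi>. \<^bold>\<forall>\<alpha>. in_ext E \<alpha> \<xi> \<^bold>\<longrightarrow> \<alpha> \<^bold>< \<xi>) \<^bold>\<and>
      limit_exists \<^bold>\<and>
      (\<^bold>\<forall>\<xi>. \<^bold>\<forall>\<eta>. \<^bold>\<forall>\<sigma>. \<^bold>\<forall>\<tau>.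
         is_sup (\<lambda>\<alpha>. in_ext E \<alpha> \<xi>) \<sigma> \<^bold>\<and> is_sup (\<lambda>\<alpha>. in_ext E \<alpha> \<eta>) \<tau> \<^bold>\<and> \<sigma> \<^bold>< \<tau> \<^bold>\<longrightarrow> \<xi> \<^bold>< \<eta>))"


section \<open>The theory \<open>MC\<^sub>A\<close>\<close>

definition encoded_in :: "ctm \<Rightarrow> ctm \<Rightarrow> form" where
  "encoded_in g E = (\<^bold>\<exists>\<alpha>. \<^bold>\<forall>\<beta>. \<beta> \<^bold>\<in> g \<^bold>\<longleftrightarrow> pair_mem \<beta> \<alpha> E)"

definition MU :: fm where
  "MU = sentence (\<^bold>\<forall>\<^sub>cg. bounded_f g \<^bold>\<longrightarrow> (\<^bold>\<exists>\<^sub>cE. is_reg_encoding E \<^bold>\<and> encoded_in g E))"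

definition tdc_f :: "(otm \<Rightarrow> ctm \<Rightarrow> ctm \<Rightarrow> form) \<Rightarrow> form" where
  "tdc_f \<Phi> =
     ((\<^bold>\<forall>\<alpha>. \<^bold>\<forall>\<^sub>cQ. is_sequence Q \<alpha> \<^bold>\<longrightarrow>
         ((\<^bold>\<exists>\<^sub>cX. \<Phi> \<alpha> X Q) \<^bold>\<longleftrightarrow>
          (\<^bold>\<forall>\<beta>. \<beta> \<^bold>< \<alpha> \<^bold>\<longrightarrow>
             (\<^bold>\<forall>\<^sub>cX. \<^bold>\<forall>\<^sub>cR. is_section Q \<beta> X \<^bold>\<and> is_restriction Q \<beta> R \<^bold>\<longrightarrow> \<Phi> \<beta> X R)))) \<^bold>\<longrightarrow>
      (\<^bold>\<exists>\<^sub>cP. \<^bold>\<forall>\<alpha>. \<^bold>\<forall>\<^sub>cX. \<^bold>\<forall>\<^sub>cR. is_section P \<alpha> X \<^bold>\<and> is_restriction P \<alpha> R \<^bold>\<longrightarrow> \<Phi> \<alpha> X R))"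

definition TDC :: "fm set" where
  "TDC = {closure p q (tdc_f (\<lambda>\<alpha> X Q. app \<phi> [\<alpha>] [X, Q])) | p q \<phi>. fm_below (1 + p) (2 + q) \<phi>}"

text \<open>\<open>\<Phi>\<close> is a hyperclass, \<open>\<Phi> D\<close> meaning that \<open>D\<close> is an element of it.\<close>

definition uniformly_bounded :: "(ctm \<Rightarrow> form) \<Rightarrow> form" where
  "uniformly_bounded \<Phi> = (\<^bold>\<exists>\<alpha>. \<^bold>\<forall>\<^sub>cD. \<Phi> D \<^bold>\<longrightarrow> bounded_by D \<alpha>)"

definition encodes_hyperclass :: "ctm \<Rightarrow> (ctm \<Rightarrow> form) \<Rightarrow> form" where
  "encodes_hyperclass C \<Phi> =
     (\<^bold>\<forall>\<^sub>cD. \<Phi> D \<^bold>\<and> (\<^bold>\<exists>\<beta>. \<beta> \<^bold>\<in> D) \<^bold>\<longrightarrow> (\<^bold>\<exists>\<^sub>1\<alpha>. is_section C \<alpha> D))"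

definition ue_f :: "(ctm \<Rightarrow> form) \<Rightarrow> form" where
  "ue_f \<Phi> = (uniformly_bounded \<Phi> \<^bold>\<longrightarrow> (\<^bold>\<exists>\<^sub>cC. bounded_f C \<^bold>\<and> encodes_hyperclass C \<Phi>))"

definition UE :: "fm set" where
  "UE = {closure p q (ue_f (\<lambda>D. app \<phi> [] [D])) | p q \<phi>. fm_below p (1 + q) \<phi>}"

definition MC_A :: "fm set" where
  "MC_A = OA \<union> {MU} \<union> TDC \<union> UE"

end

theory Submission
  imports Defs "HOL-Library.Countable"
begin

text \<open>
  By a Henkin completeness theorem for the calculus it suffices to argue in a model of \<open>MC\<^sub>A\<close>. There,
  \<open>TDC\<close> yields a sequence \<open>U\<close> of bounded classes such that \<open>U \<alpha>\<close> has minimal strict supremum among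
  the bounded classes different from all \<open>U \<beta>\<close> with \<open>\<beta> < \<alpha>\<close>. If a class \<open>g\<close> bounded by \<open>\<tau>\<close> were
  missing, then all \<open>U \<alpha>\<close> would be bounded by \<open>\<tau>\<close>; \<open>UE\<close> would inject them, hence all ordinals, into
  an ordinal, contrary to Replacement. So \<open>U\<close> enumerates the bounded classes without repetitions, and
  \<open>E = {Pair(\<beta>, \<alpha>) | \<beta> \<in> U \<alpha>}\<close> is as required: Regularity and \<open>\<alpha> \<in> x \<longrightarrow> \<alpha> < e(x)\<close> follow from
  minimality, and the schemata of \<open>SC\<close> for internal formulas are instances of those of \<open>OA\<close>, because
  the truth predicate is a formula.
\<close>

section \<open>Substitution and structural rules\<close>

text \<open>The detour through models is what makes the argument manageable: in the calculus every
  use of a schema would call for a formal derivation, whereas in a model it is the evaluation of a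
  formula at chosen parameters. The price is that least elements, Replacement and \<open>TDC\<close>
  are available in the model only for predicates exhibited as formulas. This is the reason for the
  recurring local formulas \<open>?F\<close>, each accompanied by an equivalence that states its
  meaning. Minimality of the strict supremum takes the place of a well-order of the bounded classes,
  which is not at hand. \<open>TDC\<close> picks among the candidates of a stage arbitrarily; apart
  from distinctness of the chosen classes, everything derived later is a comparison of their bounds,
  on which the arbitrary choice has no influence.\<close>

lemma tsubst_tsubst: "tsubst \<sigma> (tsubst \<sigma>' t) = tsubst (\<lambda>n. tsubst \<sigma> (\<sigma>' n)) t"
  by (induction t) auto

lemma tsubst_Var [simp]: "tsubst Var t = t"
  by (induction t) auto

lemma lift_o_comp: "tsubst (lift_o \<sigma>) (lift_o \<sigma>' n) = lift_o (\<lambda>n. tsubst \<sigma> (\<sigma>' n)) n"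
  by (cases n) (auto simp: lift_o_def tsubst_tsubst)

lemma lift_c_comp: "lift_c \<tau> (lift_c \<tau>' n) = lift_c (\<lambda>n. \<tau> (\<tau>' n)) n"
  by (cases n) (auto simp: lift_c_def)

lemma lift_o_Var [simp]: "lift_o Var = Var"
  by (auto simp: lift_o_def fun_eq_iff split: nat.split)

lemma lift_c_id [simp]: "lift_c (\<lambda>n. n) = (\<lambda>n. n)"
  by (auto simp: lift_c_def fun_eq_iff split: nat.split)

lemma fsubst_fsubst:
  "fsubst \<sigma> \<tau> (fsubst \<sigma>' \<tau>' \<phi>) = fsubst (\<lambda>n. tsubst \<sigma> (\<sigma>' n)) (\<lambda>n. \<tau> (\<tau>' n)) \<phi>"
  by (induction \<phi> arbitrary: \<sigma> \<tau> \<sigma>' \<tau>') (auto simp: tsubst_tsubst lift_o_comp lift_c_comp)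

lemma fsubst_Var [simp]: "fsubst Var (\<lambda>n. n) \<phi> = \<phi>"
  by (induction \<phi>) auto

section \<open>Dependence on finitely many free variables\<close>

lemma tsubst_cong_below:
  "tm_below n t \<Longrightarrow> (\<And>i. i < n \<Longrightarrow> \<sigma> i = \<sigma>' i) \<Longrightarrow> tsubst \<sigma> t = tsubst \<sigma>' t"
  by (induction t) auto

lemma fsubst_cong_below:
  "fm_below n m \<phi> \<Longrightarrow> (\<And>i. i < n \<Longrightarrow> \<sigma> i = \<sigma>' i) \<Longrightarrow> (\<And>j. j < m \<Longrightarrow> \<tau> j = \<tau>' j) \<Longrightarrow>
   fsubst \<sigma> \<tau> \<phi> = fsubst \<sigma>' \<tau>' \<phi>"
proof (induction \<phi> arbitrary: n m \<sigma> \<tau> \<sigma>' \<tau>')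
  case (All \<phi>)
  show ?case
    using All.prems by (auto intro!: All.IH[of "Suc n" m] simp: lift_o_def split: nat.split)
next
  case (AllC \<phi>)
  show ?case
    using AllC.prems by (auto intro!: AllC.IH[of n "Suc m"] simp: lift_c_def split: nat.split)
next
  case (Imp \<phi> \<psi>)
  then show ?case by simp metis
qed (auto intro: tsubst_cong_below)

lemma tm_below_mono: "tm_below n t \<Longrightarrow> n \<le> n' \<Longrightarrow> tm_below n' t"
  by (induction t) auto

lemma fm_below_mono: "fm_below n m \<phi> \<Longrightarrow> n \<le> n' \<Longrightarrow> m \<le> m' \<Longrightarrow> fm_below n' m' \<phi>"
proof (induction \<phi> arbitrary: n m n' m')
  case (All \<phi>)
  then show ?case using All.IH[of "Suc n" m "Suc n'" m'] by simp
next
  case (AllC \<phi>)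
  then show ?case using AllC.IH[of n "Suc m" n' "Suc m'"] by simp
qed (auto intro: tm_below_mono)

lemma ex_tm_below: "\<exists>n. tm_below n t"
proof (induction t)
  case (Add s t)
  then obtain n n' where "tm_below n s" "tm_below n' t" by blast
  then show ?case by (auto intro!: exI[of _ "max n n'"] elim: tm_below_mono)
next
  case (Mul s t)
  then obtain n n' where "tm_below n s" "tm_below n' t" by blast
  then show ?case by (auto intro!: exI[of _ "max n n'"] elim: tm_below_mono)
qed auto

lemma ex_fm_below: "\<exists>n. fm_below n n \<phi>"
proof (induction \<phi>)
  case (Less s t)
  obtain n n' where "tm_below n s" "tm_below n' t" using ex_tm_below by metis
  then show ?case by (auto intro!: exI[of _ "max n n'"] elim: tm_below_mono)
next
  case (Eq s t)
  obtain n n' where "tm_below n s" "tm_below n' t" using ex_tm_below by metis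
  then show ?case by (auto intro!: exI[of _ "max n n'"] elim: tm_below_mono)
next
  case (Mem t X)
  obtain n where "tm_below n t" using ex_tm_below by metis
  then show ?case by (auto intro!: exI[of _ "max n (Suc X)"] elim: tm_below_mono)
next
  case (EqC X Y)
  show ?case by (auto intro!: exI[of _ "max (Suc X) (Suc Y)"])
next
  case (Imp \<phi> \<psi>)
  then obtain n n' where "fm_below n n \<phi>" "fm_below n' n' \<psi>" by blast
  then show ?case by (auto intro!: exI[of _ "max n n'"] elim!: fm_below_mono)
next
  case (All \<phi>)
  then obtain n where "fm_below n n \<phi>" by blast
  then show ?case by (auto intro!: exI[of _ n] elim!: fm_below_mono)
next
  case (AllC \<phi>)
  then obtain n where "fm_below n n \<phi>" by blast
  then show ?case by (auto intro!: exI[of _ n] elim!: fm_below_mono)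
qed auto

lemma fsubst_inst_o:
  "fsubst \<sigma> \<tau> (inst_o t \<phi>) = inst_o (tsubst \<sigma> t) (fsubst (lift_o \<sigma>) \<tau> \<phi>)"
  unfolding inst_o_def fsubst_fsubst
  by (intro arg_cong2[of _ _ _ _ "\<lambda>a b. fsubst a b \<phi>"])
     (auto simp: fun_eq_iff lift_o_def tsubst_tsubst split: nat.split)

lemma fsubst_inst_c: "fsubst \<sigma> \<tau> (inst_c Y \<phi>) = inst_c (\<tau> Y) (fsubst \<sigma> (lift_c \<tau>) \<phi>)"
  unfolding inst_c_def fsubst_fsubst
  by (intro arg_cong2[of _ _ _ _ "\<lambda>a b. fsubst a b \<phi>"])
     (auto simp: fun_eq_iff lift_c_def split: nat.split)

lemma fsubst_shift_o: "fsubst (lift_o \<sigma>) \<tau> (shift_o \<phi>) = shift_o (fsubst \<sigma> \<tau> \<phi>)"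
  unfolding shift_o_def fsubst_fsubst by (simp add: lift_o_def)

lemma fsubst_shift_c: "fsubst \<sigma> (lift_c \<tau>) (shift_c \<phi>) = shift_c (fsubst \<sigma> \<tau> \<phi>)"
  unfolding shift_c_def fsubst_fsubst by (simp add: lift_c_def)

text \<open>The quantifier rules carry no side conditions: \<open>allI\<close> shifts the whole
  context, and a lifted substitution leaves index 0 alone, so substitution commutes with shifting
  and with instantiation and each rule is mapped to itself. Fresh variables are later turned into
  eigenvariables in this way.\<close>

lemma proves_fsubst: "\<Gamma> \<turnstile> \<phi> \<Longrightarrow> fsubst \<sigma> \<tau> ` \<Gamma> \<turnstile> fsubst \<sigma> \<tau> \<phi>"
proof (induction arbitrary: \<sigma> \<tau> rule: proves.induct)
  case (assm \<phi> \<Gamma>)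
  then show ?case by (auto intro: proves.assm)
next
  case (impI \<phi> \<Gamma> \<psi>)
  then show ?case by (auto intro: proves.impI)
next
  case (impE \<Gamma> \<phi> \<psi>)
  then show ?case using proves.impE by fastforce
next
  case (contr \<phi> \<Gamma>)
  have "insert (Imp (fsubst \<sigma> \<tau> \<phi>) Falsum) (fsubst \<sigma> \<tau> ` \<Gamma>) \<turnstile> Falsum"
    using contr.IH[of \<sigma> \<tau>] by simp
  then show ?case by (rule proves.contr)
next
  case (allI \<Gamma> \<phi>)
  have "shift_o ` fsubst \<sigma> \<tau> ` \<Gamma> \<turnstile> fsubst (lift_o \<sigma>) \<tau> \<phi>"
    using allI.IH[of "lift_o \<sigma>" \<tau>] by (simp add: image_image fsubst_shift_o)
  then show ?case by (auto intro: proves.allI)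
next
  case (allE \<Gamma> \<phi> t)
  then show ?case using proves.allE by (fastforce simp: fsubst_inst_o)
next
  case (allCI \<Gamma> \<phi>)
  have "shift_c ` fsubst \<sigma> \<tau> ` \<Gamma> \<turnstile> fsubst \<sigma> (lift_c \<tau>) \<phi>"
    using allCI.IH[of \<sigma> "lift_c \<tau>"] by (simp add: image_image fsubst_shift_c)
  then show ?case by (auto intro: proves.allCI)
next
  case (allCE \<Gamma> \<phi> Y)
  then show ?case using proves.allCE by (fastforce simp: fsubst_inst_c)
next
  case (eq_refl \<Gamma> t)
  then show ?case by (auto intro: proves.eq_refl)
next
  case (eq_subst \<Gamma> s t \<phi>)
  then show ?case using proves.eq_subst by (fastforce simp: fsubst_inst_o)
next
  case (eqC_refl \<Gamma> X)
  then show ?case by (auto intro: proves.eqC_refl)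
next
  case (eqC_subst \<Gamma> X Y \<phi>)
  then show ?case using proves.eqC_subst by (fastforce simp: fsubst_inst_c)
qed

lemma proves_mono: "\<Gamma> \<turnstile> \<phi> \<Longrightarrow> \<Gamma> \<subseteq> \<Delta> \<Longrightarrow> \<Delta> \<turnstile> \<phi>"
proof (induction arbitrary: \<Delta> rule: proves.induct)
  case (impI \<phi> \<Gamma> \<psi>)
  then show ?case by (meson insert_mono proves.impI)
next
  case (contr \<phi> \<Gamma>)
  then show ?case by (meson insert_mono proves.contr)
next
  case (allI \<Gamma> \<phi>)
  then show ?case by (meson image_mono proves.allI)
next
  case (allCI \<Gamma> \<phi>)
  then show ?case by (meson image_mono proves.allCI)
qed (blast intro: proves.assm proves.impE proves.allE proves.allCE proves.eq_refl proves.eq_subst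
      proves.eqC_refl proves.eqC_subst)+

text \<open>Compactness, needed to see that the union of a chain of consistent sets is consistent.
  In the quantifier cases a finite part of a shifted context is itself the shift of a finite
  part.\<close>

lemma proves_finite: "\<Gamma> \<turnstile> \<phi> \<Longrightarrow> \<exists>\<Delta>. finite \<Delta> \<and> \<Delta> \<subseteq> \<Gamma> \<and> \<Delta> \<turnstile> \<phi>"
proof (induction rule: proves.induct)
  case (assm \<phi> \<Gamma>)
  then show ?case by (intro exI[of _ "{\<phi>}"]) (auto intro: proves.assm)
next
  case (impI \<phi> \<Gamma> \<psi>)
  then obtain \<Delta> where "finite \<Delta>" "\<Delta> \<subseteq> insert \<phi> \<Gamma>" "\<Delta> \<turnstile> \<psi>" by blast
  moreover from this have "\<Delta> - {\<phi>} \<turnstile> Imp \<phi> \<psi>"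
    by (auto intro!: proves.impI elim: proves_mono)
  ultimately show ?case
    by (intro exI[of _ "\<Delta> - {\<phi>}"]) auto
next
  case (impE \<Gamma> \<phi> \<psi>)
  then obtain \<Delta> \<Delta>' where "finite \<Delta>" "\<Delta> \<subseteq> \<Gamma>" "\<Delta> \<turnstile> Imp \<phi> \<psi>" "finite \<Delta>'" "\<Delta>' \<subseteq> \<Gamma>" "\<Delta>' \<turnstile> \<phi>"
    by blast
  then show ?case
    using proves.impE[OF proves_mono[OF _ Un_upper1] proves_mono[OF _ Un_upper2]]
    by (intro exI[of _ "\<Delta> \<union> \<Delta>'"]) blast
next
  case (contr \<phi> \<Gamma>)
  then obtain \<Delta> where "finite \<Delta>" "\<Delta> \<subseteq> insert (Imp \<phi> Falsum) \<Gamma>" "\<Delta> \<turnstile> Falsum" by blast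
  moreover from this(3) have "insert (Imp \<phi> Falsum) (\<Delta> - {Imp \<phi> Falsum}) \<turnstile> Falsum"
    by (rule proves_mono) blast
  then have "\<Delta> - {Imp \<phi> Falsum} \<turnstile> \<phi>"
    by (rule proves.contr)
  ultimately show ?case
    by (intro exI[of _ "\<Delta> - {Imp \<phi> Falsum}"]) auto
next
  case (allI \<Gamma> \<phi>)
  then obtain \<Delta> where "finite \<Delta>" "\<Delta> \<subseteq> shift_o ` \<Gamma>" "\<Delta> \<turnstile> \<phi>" by blast
  moreover from this obtain \<Theta> where "\<Theta> \<subseteq> \<Gamma>" "finite \<Theta>" "\<Delta> = shift_o ` \<Theta>"
    by (meson finite_subset_image)
  ultimately show ?case by (auto intro: proves.allI)
next
  case (allCI \<Gamma> \<phi>)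
  then obtain \<Delta> where "finite \<Delta>" "\<Delta> \<subseteq> shift_c ` \<Gamma>" "\<Delta> \<turnstile> \<phi>" by blast
  moreover from this obtain \<Theta> where "\<Theta> \<subseteq> \<Gamma>" "finite \<Theta>" "\<Delta> = shift_c ` \<Theta>"
    by (meson finite_subset_image)
  ultimately show ?case by (auto intro: proves.allCI)
next
  case (eq_subst \<Gamma> s t \<phi>)
  then obtain \<Delta> \<Delta>' where "finite \<Delta>" "\<Delta> \<subseteq> \<Gamma>" "\<Delta> \<turnstile> Eq s t"
    "finite \<Delta>'" "\<Delta>' \<subseteq> \<Gamma>" "\<Delta>' \<turnstile> inst_o s \<phi>"
    by blast
  then show ?case
    using proves.eq_subst[OF proves_mono[OF _ Un_upper1] proves_mono[OF _ Un_upper2]]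
    by (intro exI[of _ "\<Delta> \<union> \<Delta>'"]) blast
next
  case (eqC_subst \<Gamma> X Y \<phi>)
  then obtain \<Delta> \<Delta>' where "finite \<Delta>" "\<Delta> \<subseteq> \<Gamma>" "\<Delta> \<turnstile> EqC X Y"
    "finite \<Delta>'" "\<Delta>' \<subseteq> \<Gamma>" "\<Delta>' \<turnstile> inst_c X \<phi>"
    by blast
  then show ?case
    using proves.eqC_subst[OF proves_mono[OF _ Un_upper1] proves_mono[OF _ Un_upper2]]
    by (intro exI[of _ "\<Delta> \<union> \<Delta>'"]) blast
qed (blast intro: proves.allE proves.allCE proves.eq_refl proves.eqC_refl)+

section \<open>Consistency and fresh variables\<close>

definition consistent :: "fm set \<Rightarrow> bool" where
  "consistent \<Gamma> \<longleftrightarrow> \<not> \<Gamma> \<turnstile> Falsum"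

lemma proves_cut: "\<Gamma> \<turnstile> \<phi> \<Longrightarrow> insert \<phi> \<Gamma> \<turnstile> \<psi> \<Longrightarrow> \<Gamma> \<turnstile> \<psi>"
  using proves.impE proves.impI by blast

lemma consistent_insert_neg: "\<not> \<Gamma> \<turnstile> \<phi> \<Longrightarrow> consistent (insert (Imp \<phi> Falsum) \<Gamma>)"
  unfolding consistent_def using proves.contr by blast

text \<open>Freshness in terms of substitution is immediate both for contexts whose variables have been
  renamed and for formulas bounded by \<open>fm_below\<close>.\<close>

definition fresh_o :: "nat \<Rightarrow> fm \<Rightarrow> bool" where
  "fresh_o k \<phi> \<longleftrightarrow> (\<forall>\<sigma> \<sigma>' \<tau>. (\<forall>i. i \<noteq> k \<longrightarrow> \<sigma> i = \<sigma>' i) \<longrightarrow> fsubst \<sigma> \<tau> \<phi> = fsubst \<sigma>' \<tau> \<phi>)"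

definition fresh_c :: "nat \<Rightarrow> fm \<Rightarrow> bool" where
  "fresh_c k \<phi> \<longleftrightarrow> (\<forall>\<sigma> \<tau> \<tau>'. (\<forall>i. i \<noteq> k \<longrightarrow> \<tau> i = \<tau>' i) \<longrightarrow> fsubst \<sigma> \<tau> \<phi> = fsubst \<sigma> \<tau>' \<phi>)"

lemma fresh_o_below: "fm_below n m \<phi> \<Longrightarrow> n \<le> k \<Longrightarrow> fresh_o k \<phi>"
  unfolding fresh_o_def by (auto intro!: fsubst_cong_below)

lemma fresh_c_below: "fm_below n m \<phi> \<Longrightarrow> m \<le> k \<Longrightarrow> fresh_c k \<phi>"
  unfolding fresh_c_def by (auto intro!: fsubst_cong_below)

text \<open>The substitution \<open>?r\<close> makes the fresh variable \<open>k\<close> the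
  eigenvariable 0 and raises all others. On the context it agrees with \<open>shift_o\<close>, and
  it undoes the instantiation of \<open>\<psi>\<close>, so that \<open>allI\<close> applies.
  Freshness in \<open>\<psi>\<close> concerns \<open>Suc k\<close> because \<open>\<psi>\<close>
  lies under one more binder.\<close>

lemma proves_all_fresh:
  assumes "\<And>\<chi>. \<chi> \<in> \<Gamma> \<Longrightarrow> fresh_o k \<chi>" and "fresh_o (Suc k) \<psi>" and "\<Gamma> \<turnstile> inst_o (Var k) \<psi>"
  shows "\<Gamma> \<turnstile> All \<psi>"
proof -
  let ?r = "\<lambda>i. if i = k then Var 0 else Var (Suc i)"
  have 1: "fsubst ?r (\<lambda>n. n) \<chi> = shift_o \<chi>" if "\<chi> \<in> \<Gamma>" for \<chi>
    using assms(1)[OF that] unfolding fresh_o_def shift_o_def by auto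
  have "fsubst ?r (\<lambda>n. n) (inst_o (Var k) \<psi>) = fsubst (case_nat (Var 0) ?r) (\<lambda>n. n) \<psi>"
    unfolding inst_o_def fsubst_fsubst
    by (intro arg_cong2[of _ _ _ _ "\<lambda>a b. fsubst a b \<psi>"]) (auto split: nat.split)
  also have "\<dots> = fsubst Var (\<lambda>n. n) \<psi>"
    by (rule assms(2)[unfolded fresh_o_def, rule_format]) (auto split: nat.split)
  finally have 2: "fsubst ?r (\<lambda>n. n) (inst_o (Var k) \<psi>) = \<psi>" by simp
  have "fsubst ?r (\<lambda>n. n) ` \<Gamma> = shift_o ` \<Gamma>"
    using 1 by (rule image_cong[OF refl])
  then have "shift_o ` \<Gamma> \<turnstile> \<psi>"
    using proves_fsubst[OF assms(3), of ?r "\<lambda>n. n"] unfolding 2 by simp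
  then show ?thesis by (rule proves.allI)
qed

lemma proves_allC_fresh:
  assumes "\<And>\<chi>. \<chi> \<in> \<Gamma> \<Longrightarrow> fresh_c k \<chi>" and "fresh_c (Suc k) \<psi>" and "\<Gamma> \<turnstile> inst_c k \<psi>"
  shows "\<Gamma> \<turnstile> AllC \<psi>"
proof -
  let ?r = "\<lambda>i. if i = k then 0 else Suc i"
  have 1: "fsubst Var ?r \<chi> = shift_c \<chi>" if "\<chi> \<in> \<Gamma>" for \<chi>
    using assms(1)[OF that] unfolding fresh_c_def shift_c_def by auto
  have "fsubst Var ?r (inst_c k \<psi>) = fsubst Var (case_nat 0 ?r) \<psi>"
    unfolding inst_c_def fsubst_fsubst
    by (intro arg_cong2[of _ _ _ _ "\<lambda>a b. fsubst a b \<psi>"]) (auto split: nat.split)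
  also have "\<dots> = fsubst Var (\<lambda>n. n) \<psi>"
    by (rule assms(2)[unfolded fresh_c_def, rule_format]) (auto split: nat.split)
  finally have 2: "fsubst Var ?r (inst_c k \<psi>) = \<psi>" by simp
  have "fsubst Var ?r ` \<Gamma> = shift_c ` \<Gamma>"
    using 1 by (rule image_cong[OF refl])
  then have "shift_c ` \<Gamma> \<turnstile> \<psi>"
    using proves_fsubst[OF assms(3), of Var ?r] unfolding 2 by simp
  then show ?thesis by (rule proves.allCI)
qed

instance tm :: countable by countable_datatype
instance fm :: countable by countable_datatype

section \<open>Henkin sets\<close>

text \<open>The last two conjuncts are the witness property in contrapositive form. For classes the
  instances range over variables, the only class terms.\<close>

definition henkin_set :: "fm set \<Rightarrow> bool" where
  "henkin_set H \<longleftrightarrow> consistent H \<and> (\<forall>\<phi>. H \<turnstile> \<phi> \<longrightarrow> \<phi> \<in> H) \<and>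
     (\<forall>\<phi>. \<phi> \<notin> H \<longrightarrow> Imp \<phi> Falsum \<in> H) \<and>
     (\<forall>\<psi>. (\<forall>t. inst_o t \<psi> \<in> H) \<longrightarrow> All \<psi> \<in> H) \<and>
     (\<forall>\<psi>. (\<forall>k. inst_c k \<psi> \<in> H) \<longrightarrow> AllC \<psi> \<in> H)"

definition spacious :: "fm set \<Rightarrow> bool" where
  "spacious \<Gamma> \<longleftrightarrow> (\<forall>n. \<exists>k\<ge>n. \<forall>\<chi>\<in>\<Gamma>. fresh_o k \<chi>) \<and> (\<forall>n. \<exists>k\<ge>n. \<forall>\<chi>\<in>\<Gamma>. fresh_c k \<chi>)"

lemma spacious_insert:
  assumes "spacious \<Gamma>"
  shows "spacious (insert \<phi> \<Gamma>)"
proof -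
  obtain b where b: "fm_below b b \<phi>" using ex_fm_below by blast
  have "\<exists>k\<ge>n. \<forall>\<chi>\<in>insert \<phi> \<Gamma>. fresh_o k \<chi>" for n
  proof -
    obtain k where "k \<ge> max n b" "\<forall>\<chi>\<in>\<Gamma>. fresh_o k \<chi>"
      using assms unfolding spacious_def by blast
    then show ?thesis using fresh_o_below[OF b] by (intro exI[of _ k]) auto
  qed
  moreover have "\<exists>k\<ge>n. \<forall>\<chi>\<in>insert \<phi> \<Gamma>. fresh_c k \<chi>" for n
  proof -
    obtain k where "k \<ge> max n b" "\<forall>\<chi>\<in>\<Gamma>. fresh_c k \<chi>"
      using assms unfolding spacious_def by blast
    then show ?thesis using fresh_c_below[OF b] by (intro exI[of _ k]) auto
  qed
  ultimately show ?thesis unfolding spacious_def by blast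
qed

text \<open>If a variable fresh for \<open>\<Gamma>\<close> and \<open>\<psi>\<close> could not be a
  counterexample, then \<open>\<Gamma>\<close> would prove the generic instance and hence
  \<open>All \<psi>\<close>.\<close>

lemma consistent_witness_o:
  assumes "spacious \<Gamma>" and "consistent \<Gamma>" and "Imp (All \<psi>) Falsum \<in> \<Gamma>"
  shows "\<exists>k. consistent (insert (Imp (inst_o (Var k) \<psi>) Falsum) \<Gamma>)"
proof -
  obtain b where b: "fm_below b b \<psi>" using ex_fm_below by blast
  obtain k where k: "k \<ge> b" "\<forall>\<chi>\<in>\<Gamma>. fresh_o k \<chi>"
    using assms(1) unfolding spacious_def by blast
  have "\<not> \<Gamma> \<turnstile> inst_o (Var k) \<psi>"
  proof
    assume "\<Gamma> \<turnstile> inst_o (Var k) \<psi>"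
    then have "\<Gamma> \<turnstile> All \<psi>"
      using k fresh_o_below[OF b] by (intro proves_all_fresh) auto
    then show False
      using assms(2,3) proves.assm proves.impE unfolding consistent_def by blast
  qed
  then show ?thesis using consistent_insert_neg by blast
qed

lemma consistent_witness_c:
  assumes "spacious \<Gamma>" and "consistent \<Gamma>" and "Imp (AllC \<psi>) Falsum \<in> \<Gamma>"
  shows "\<exists>k. consistent (insert (Imp (inst_c k \<psi>) Falsum) \<Gamma>)"
proof -
  obtain b where b: "fm_below b b \<psi>" using ex_fm_below by blast
  obtain k where k: "k \<ge> b" "\<forall>\<chi>\<in>\<Gamma>. fresh_c k \<chi>"
    using assms(1) unfolding spacious_def by blast
  have "\<not> \<Gamma> \<turnstile> inst_c k \<psi>"
  proof
    assume "\<Gamma> \<turnstile> inst_c k \<psi>"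
    then have "\<Gamma> \<turnstile> AllC \<psi>"
      using k fresh_c_below[OF b] by (intro proves_allC_fresh) auto
    then show False
      using assms(2,3) proves.assm proves.impE unfolding consistent_def by blast
  qed
  then show ?thesis using consistent_insert_neg by blast
qed

text \<open>A negated universal formula is added together with a counterexample. A rejected
  \<open>\<phi>\<close> is recorded as inconsistent with \<open>\<Gamma>\<close>, a property
  inherited by all larger sets, so the decision remains valid in the limit.\<close>

lemma lindenbaum_step:
  assumes "spacious \<Gamma>" and "consistent \<Gamma>"
  obtains \<Delta> where "spacious \<Delta>" "consistent \<Delta>" "\<Gamma> \<subseteq> \<Delta>" "\<phi> \<in> \<Delta> \<or> \<not> consistent (insert \<phi> \<Gamma>)"
    "\<And>\<psi>. \<phi> = Imp (All \<psi>) Falsum \<Longrightarrow> \<phi> \<in> \<Delta> \<Longrightarrow> \<exists>t. Imp (inst_o t \<psi>) Falsum \<in> \<Delta>"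
    "\<And>\<psi>. \<phi> = Imp (AllC \<psi>) Falsum \<Longrightarrow> \<phi> \<in> \<Delta> \<Longrightarrow> \<exists>k. Imp (inst_c k \<psi>) Falsum \<in> \<Delta>"
proof (cases "consistent (insert \<phi> \<Gamma>)")
  case con: True
  have sp: "spacious (insert \<phi> \<Gamma>)" using assms(1) by (rule spacious_insert)
  show ?thesis
  proof (cases "\<exists>\<psi>. \<phi> = Imp (All \<psi>) Falsum")
    case True
    then obtain \<psi> where \<psi>: "\<phi> = Imp (All \<psi>) Falsum" by blast
    then obtain k where "consistent (insert (Imp (inst_o (Var k) \<psi>) Falsum) (insert \<phi> \<Gamma>))"
      using consistent_witness_o[OF sp con] by blast
    then show ?thesis
      by (rule that[rotated]) (use \<psi> sp in \<open>auto intro: spacious_insert\<close>)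
  next
    case no: False
    show ?thesis
    proof (cases "\<exists>\<psi>. \<phi> = Imp (AllC \<psi>) Falsum")
      case True
      then obtain \<psi> where \<psi>: "\<phi> = Imp (AllC \<psi>) Falsum" by blast
      then obtain k where "consistent (insert (Imp (inst_c k \<psi>) Falsum) (insert \<phi> \<Gamma>))"
        using consistent_witness_c[OF sp con] by blast
      then show ?thesis
        by (rule that[rotated]) (use \<psi> sp in \<open>auto intro: spacious_insert\<close>)
    next
      case False
      then show ?thesis using no con sp by (intro that[of "insert \<phi> \<Gamma>"]) auto
    qed
  qed
next
  case False
  then have "\<phi> \<notin> \<Gamma>" using assms(2) by (auto simp: insert_absorb)
  with False show ?thesis using assms by (intro that[of \<Gamma>]) auto
qed

text \<open>Formulas are countable, so a chain of length omega that treats the n-th formula at step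
  n suffices.\<close>

lemma henkin_extension:
  assumes "spacious \<Gamma>" and "consistent \<Gamma>"
  shows "\<exists>H. \<Gamma> \<subseteq> H \<and> henkin_set H"
proof -
  define Q where "Q = (\<lambda>(n::nat) \<Gamma> \<Delta>. spacious \<Delta> \<and> consistent \<Delta> \<and> \<Gamma> \<subseteq> \<Delta> \<and>
    (from_nat n \<in> \<Delta> \<or> \<not> consistent (insert (from_nat n) \<Gamma>)) \<and>
    (\<forall>\<psi>. from_nat n = Imp (All \<psi>) Falsum \<longrightarrow> from_nat n \<in> \<Delta> \<longrightarrow>
       (\<exists>t. Imp (inst_o t \<psi>) Falsum \<in> \<Delta>)) \<and>
    (\<forall>\<psi>. from_nat n = Imp (AllC \<psi>) Falsum \<longrightarrow> from_nat n \<in> \<Delta> \<longrightarrow>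
       (\<exists>k. Imp (inst_c k \<psi>) Falsum \<in> \<Delta>)))"
  have "\<exists>f. f 0 = \<Gamma> \<and> (\<forall>n. (spacious (f n) \<and> consistent (f n)) \<and> Q n (f n) (f (Suc n)))"
  \<comment> \<open>Dependent choice leaves the first member open; the conjunct about
    \<open>n = 0\<close> fixes it to be \<open>\<Gamma>\<close>.\<close>
  proof (rule exE[OF dependent_nat_choice[of "\<lambda>n \<Delta>. spacious \<Delta> \<and> consistent \<Delta> \<and> (n = 0 \<longrightarrow> \<Delta> = \<Gamma>)" Q]])
    show "\<exists>\<Delta>. spacious \<Delta> \<and> consistent \<Delta> \<and> (0 = (0::nat) \<longrightarrow> \<Delta> = \<Gamma>)" using assms by blast
  next
    fix \<Theta> and n :: nat
    assume "spacious \<Theta> \<and> consistent \<Theta> \<and> (n = 0 \<longrightarrow> \<Theta> = \<Gamma>)"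
    then have sc: "spacious \<Theta>" "consistent \<Theta>" by blast+
    obtain \<Delta> where "Q n \<Theta> \<Delta>"
      by (rule lindenbaum_step[OF sc, of "from_nat n"]) (unfold Q_def, blast)
    then show "\<exists>\<Delta>. (spacious \<Delta> \<and> consistent \<Delta> \<and> (Suc n = 0 \<longrightarrow> \<Delta> = \<Gamma>)) \<and> Q n \<Theta> \<Delta>"
      unfolding Q_def by blast
  qed blast
  then obtain f where f0: "f 0 = \<Gamma>" and con: "\<And>n. consistent (f n)"
    and Q: "\<And>n. Q n (f n) (f (Suc n))" by blast
  define H where "H = (\<Union>n. f n)"
  have mono: "f n \<subseteq> f m" if "n \<le> m" for n m
    by (rule lift_Suc_mono_le[OF _ that]) (use Q in \<open>auto simp: Q_def\<close>)
  have fin: "\<exists>n. \<Delta> \<subseteq> f n" if "finite \<Delta>" "\<Delta> \<subseteq> H" for \<Delta>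
    using that
  proof (induction \<Delta>)
    case (insert \<phi> \<Delta>)
    then obtain n m where "\<Delta> \<subseteq> f n" "\<phi> \<in> f m" by (auto simp: H_def)
    then have "insert \<phi> \<Delta> \<subseteq> f (max n m)" using mono[of n "max n m"] mono[of m "max n m"] by auto
    then show ?case by blast
  qed auto
  have conH: "consistent H"
    unfolding consistent_def
  proof
    assume "H \<turnstile> Falsum"
    then obtain \<Delta> where "finite \<Delta>" "\<Delta> \<subseteq> H" "\<Delta> \<turnstile> Falsum" using proves_finite by blast
    moreover from this obtain n where "\<Delta> \<subseteq> f n" using fin by blast
    ultimately have "f n \<turnstile> Falsum" using proves_mono by blast
    then show False using con unfolding consistent_def by blast
  qed
  have sub: "f n \<subseteq> H" for n unfolding H_def by blast
  have max: "\<phi> \<in> H" if "consistent (insert \<phi> H)" for \<phi>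
  proof -
    have "consistent (insert \<phi> (f (to_nat \<phi>)))"
      using that proves_mono[OF _ insert_mono[OF sub]] unfolding consistent_def by blast
    then show ?thesis using Q[of "to_nat \<phi>"] sub unfolding Q_def by auto
  qed
  have closed: "\<phi> \<in> H" if "H \<turnstile> \<phi>" for \<phi>
    using that conH proves_cut max unfolding consistent_def by blast
  have neg: "Imp \<phi> Falsum \<in> H" if "\<phi> \<notin> H" for \<phi>
    using that max closed proves.impI unfolding consistent_def by blast
  have wit: "Imp \<phi> Falsum \<in> H \<Longrightarrow> \<phi> \<in> H \<Longrightarrow> False" for \<phi>
    using conH proves.assm proves.impE unfolding consistent_def by blast
  \<comment> \<open>A member of the limit has entered by the end of its own step, since it is
    consistent with the stage reached there. Its counterexample entered in that same step.\<close>
  have inf: "\<phi> \<in> f (Suc (to_nat \<phi>))" if "\<phi> \<in> H" for \<phi>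
  proof -
    have "insert \<phi> (f (to_nat \<phi>)) \<subseteq> H" using that sub by auto
    then have "consistent (insert \<phi> (f (to_nat \<phi>)))"
      using conH proves_mono unfolding consistent_def by blast
    then show ?thesis using Q[of "to_nat \<phi>"] unfolding Q_def by auto
  qed
  have "All \<psi> \<in> H" if all: "\<forall>t. inst_o t \<psi> \<in> H" for \<psi>
  proof (rule ccontr)
    assume "All \<psi> \<notin> H"
    then have "Imp (All \<psi>) Falsum \<in> H" by (rule neg)
    from inf[OF this] obtain t where "Imp (inst_o t \<psi>) Falsum \<in> H"
      using Q[of "to_nat (Imp (All \<psi>) Falsum)"] sub unfolding Q_def by auto
    then show False using wit all by blast
  qed
  moreover have "AllC \<psi> \<in> H" if all: "\<forall>k. inst_c k \<psi> \<in> H" for \<psi>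
  proof (rule ccontr)
    assume "AllC \<psi> \<notin> H"
    then have "Imp (AllC \<psi>) Falsum \<in> H" by (rule neg)
    from inf[OF this] obtain t where "Imp (inst_c t \<psi>) Falsum \<in> H"
      using Q[of "to_nat (Imp (AllC \<psi>) Falsum)"] sub unfolding Q_def by auto
    then show False using wit all by blast
  qed
  ultimately have "henkin_set H"
    unfolding henkin_set_def using conH closed neg by blast
  moreover have "\<Gamma> \<subseteq> H" using sub[of 0] f0 by simp
  ultimately show ?thesis by blast
qed

text \<open>Renaming the variables to even ones leaves infinitely many fresh variables; halving the
  indices undoes the renaming, so consistency is preserved.\<close>

definition rename_even :: "fm \<Rightarrow> fm" where
  "rename_even = fsubst (\<lambda>n. Var (2 * n)) (\<lambda>n. 2 * n)"

lemma spacious_rename_even: "spacious (rename_even ` \<Gamma>)"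
proof -
  have odd: "2 * i \<noteq> Suc (2 * n)" for i n :: nat by presburger
  have "fresh_o (Suc (2 * n)) (rename_even \<phi>)" and "fresh_c (Suc (2 * n)) (rename_even \<phi>)" for n \<phi>
    unfolding fresh_o_def fresh_c_def rename_even_def fsubst_fsubst tsubst.simps
    by (simp_all add: odd)
  moreover have "n \<le> Suc (2 * n)" for n :: nat by simp
  ultimately show ?thesis unfolding spacious_def by blast
qed

lemma consistent_rename_even:
  assumes "consistent \<Gamma>"
  shows "consistent (rename_even ` \<Gamma>)"
proof -
  have "fsubst (\<lambda>n. Var (n div 2)) (\<lambda>n. n div 2) ` rename_even ` \<Gamma> = \<Gamma>"
    unfolding rename_even_def image_image fsubst_fsubst by simp
  then show ?thesis
    using assms proves_fsubst[of "rename_even ` \<Gamma>" Falsum "\<lambda>n. Var (n div 2)" "\<lambda>n. n div 2"]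
    unfolding consistent_def by auto
qed

section \<open>Semantics\<close>

text \<open>General (Henkin) semantics: the second sort is an arbitrary domain with an arbitrary
  membership relation, so that extensionality and comprehension have to come from the
  axioms.\<close>

locale two_sorted =
  fixes lt :: "'o \<Rightarrow> 'o \<Rightarrow> bool" and ad mu :: "'o \<Rightarrow> 'o \<Rightarrow> 'o" and mem :: "'o \<Rightarrow> 'c \<Rightarrow> bool"
begin

primrec tval :: "(nat \<Rightarrow> 'o) \<Rightarrow> tm \<Rightarrow> 'o" where
  "tval \<rho> (Var n) = \<rho> n"
| "tval \<rho> (Add s t) = ad (tval \<rho> s) (tval \<rho> t)"
| "tval \<rho> (Mul s t) = mu (tval \<rho> s) (tval \<rho> t)"

primrec sat :: "(nat \<Rightarrow> 'o) \<Rightarrow> (nat \<Rightarrow> 'c) \<Rightarrow> fm \<Rightarrow> bool" where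
  "sat \<rho> \<kappa> (Less s t) \<longleftrightarrow> lt (tval \<rho> s) (tval \<rho> t)"
| "sat \<rho> \<kappa> (Eq s t) \<longleftrightarrow> tval \<rho> s = tval \<rho> t"
| "sat \<rho> \<kappa> (Mem t X) \<longleftrightarrow> mem (tval \<rho> t) (\<kappa> X)"
| "sat \<rho> \<kappa> (EqC X Y) \<longleftrightarrow> \<kappa> X = \<kappa> Y"
| "sat \<rho> \<kappa> Falsum \<longleftrightarrow> False"
| "sat \<rho> \<kappa> (Imp \<phi> \<psi>) \<longleftrightarrow> (sat \<rho> \<kappa> \<phi> \<longrightarrow> sat \<rho> \<kappa> \<psi>)"
| "sat \<rho> \<kappa> (All \<phi>) \<longleftrightarrow> (\<forall>x. sat (case_nat x \<rho>) \<kappa> \<phi>)"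
| "sat \<rho> \<kappa> (AllC \<phi>) \<longleftrightarrow> (\<forall>X. sat \<rho> (case_nat X \<kappa>) \<phi>)"

lemma tval_tsubst: "tval \<rho> (tsubst \<sigma> t) = tval (\<lambda>i. tval \<rho> (\<sigma> i)) t"
  by (induction t) auto

lemma sat_fsubst: "sat \<rho> \<kappa> (fsubst \<sigma> \<tau> \<phi>) \<longleftrightarrow> sat (\<lambda>i. tval \<rho> (\<sigma> i)) (\<lambda>j. \<kappa> (\<tau> j)) \<phi>"
proof (induction \<phi> arbitrary: \<rho> \<kappa> \<sigma> \<tau>)
  case (All \<phi>)
  have "(\<lambda>i. tval (case_nat x \<rho>) (lift_o \<sigma> i)) = case_nat x (\<lambda>i. tval \<rho> (\<sigma> i))" for x
    by (auto simp: fun_eq_iff lift_o_def tval_tsubst split: nat.split)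
  then show ?case by (simp add: All.IH)
next
  case (AllC \<phi>)
  have "(\<lambda>j. case_nat X \<kappa> (lift_c \<tau> j)) = case_nat X (\<lambda>j. \<kappa> (\<tau> j))" for X
    by (auto simp: fun_eq_iff lift_c_def split: nat.split)
  then show ?case by (simp add: AllC.IH)
qed (auto simp: tval_tsubst)

lemma tval_cong_below: "tm_below n t \<Longrightarrow> (\<And>i. i < n \<Longrightarrow> \<rho> i = \<rho>' i) \<Longrightarrow> tval \<rho> t = tval \<rho>' t"
  by (induction t) auto

lemma sat_cong_below:
  "fm_below n m \<phi> \<Longrightarrow> (\<And>i. i < n \<Longrightarrow> \<rho> i = \<rho>' i) \<Longrightarrow> (\<And>j. j < m \<Longrightarrow> \<kappa> j = \<kappa>' j) \<Longrightarrow>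
   sat \<rho> \<kappa> \<phi> \<longleftrightarrow> sat \<rho>' \<kappa>' \<phi>"
proof (induction \<phi> arbitrary: n m \<rho> \<kappa> \<rho>' \<kappa>')
  case (Less s t)
  then have "tval \<rho> s = tval \<rho>' s" "tval \<rho> t = tval \<rho>' t"
    using tval_cong_below[of n _ \<rho> \<rho>'] by simp_all
  then show ?case by simp
next
  case (Eq s t)
  then have "tval \<rho> s = tval \<rho>' s" "tval \<rho> t = tval \<rho>' t"
    using tval_cong_below[of n _ \<rho> \<rho>'] by simp_all
  then show ?case by simp
next
  case (Mem t X)
  then have "tval \<rho> t = tval \<rho>' t"
    using tval_cong_below[of n _ \<rho> \<rho>'] by simp_all
  then show ?case using Mem by simp
next
  case (Imp \<phi> \<psi>)
  have "sat \<rho> \<kappa> \<phi> \<longleftrightarrow> sat \<rho>' \<kappa>' \<phi>"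
    using Imp.prems by (intro Imp.IH(1)[of n m]) simp_all
  moreover have "sat \<rho> \<kappa> \<psi> \<longleftrightarrow> sat \<rho>' \<kappa>' \<psi>"
    using Imp.prems by (intro Imp.IH(2)[of n m]) simp_all
  ultimately show ?case by simp
next
  case (All \<phi>)
  have "sat (case_nat x \<rho>) \<kappa> \<phi> \<longleftrightarrow> sat (case_nat x \<rho>') \<kappa>' \<phi>" for x
    using All.prems by (intro All.IH[of "Suc n" m]) (auto split: nat.split)
  then show ?case by simp
next
  case (AllC \<phi>)
  have "sat \<rho> (case_nat X \<kappa>) \<phi> \<longleftrightarrow> sat \<rho>' (case_nat X \<kappa>') \<phi>" for X
    using AllC.prems by (intro AllC.IH[of n "Suc m"]) (auto split: nat.split)
  then show ?case by simp
qed auto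

end

text \<open>The quotients by provable equality enter only through abstract surjections
  \<open>qo\<close> and \<open>qc\<close>, which leaves open by which types they are
  realised.\<close>

theorem term_model:
  fixes qo :: "tm \<Rightarrow> 'o" and qc :: "nat \<Rightarrow> 'c"
  assumes H: "henkin_set H"
    and qo: "surj qo" "\<And>s t. qo s = qo t \<longleftrightarrow> Eq s t \<in> H"
    and qc: "surj qc" "\<And>X Y. qc X = qc Y \<longleftrightarrow> EqC X Y \<in> H"
  shows "\<exists>lt ad mu mem. \<forall>\<phi> \<sigma> \<tau>.
    two_sorted.sat lt ad mu mem (\<lambda>i. qo (\<sigma> i)) (\<lambda>j. qc (\<tau> j)) \<phi> \<longleftrightarrow> fsubst \<sigma> \<tau> \<phi> \<in> H"
proof -
  have closed: "\<And>\<phi>. H \<turnstile> \<phi> \<longleftrightarrow> \<phi> \<in> H" and con: "\<not> H \<turnstile> Falsum"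
    and neg: "\<And>\<phi>. \<phi> \<notin> H \<Longrightarrow> Imp \<phi> Falsum \<in> H"
    and wit: "\<And>\<psi>. (\<forall>t. inst_o t \<psi> \<in> H) \<Longrightarrow> All \<psi> \<in> H" "\<And>\<psi>. (\<forall>k. inst_c k \<psi> \<in> H) \<Longrightarrow> AllC \<psi> \<in> H"
    using H proves.assm unfolding henkin_set_def consistent_def by blast+
  have unshift: "tsubst (case_nat s Var) (tsubst (\<lambda>k. Var (Suc k)) t) = t" for s t
    by (simp add: tsubst_tsubst)
  have eqD: "inst_o t \<phi> \<in> H" if "qo s = qo t" "inst_o s \<phi> \<in> H" for s t \<phi>
    using that proves.eq_subst[of H s t \<phi>] by (simp add: closed qo(2))
  have eqCD: "inst_c Y \<phi> \<in> H" if "qc X = qc Y" "inst_c X \<phi> \<in> H" for X Y \<phi>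
    using that proves.eqC_subst[of H X Y \<phi>] by (simp add: closed qc(2))
  \<comment> \<open>\<open>eq_subst\<close> replaces the variable 0 of a formula. Lifting the other
    terms with \<open>?up\<close> keeps them clear of that variable.\<close>
  let ?up = "tsubst (\<lambda>k. Var (Suc k))"
  have Less: "Less s' t' \<in> H" if "qo s = qo s'" "qo t = qo t'" "Less s t \<in> H" for s t s' t'
  proof -
    have "Less s' t \<in> H"
      using eqD[OF that(1), of "Less (Var 0) (?up t)"] that(3) by (simp add: inst_o_def unshift)
    then show ?thesis
      using eqD[OF that(2), of "Less (?up s') (Var 0)"] by (simp add: inst_o_def unshift)
  qed
  have Add: "qo (Add s t) = qo (Add s' t')" if "qo s = qo s'" "qo t = qo t'" for s t s' t'
  proof -
    have "Eq (Add s t) (Add s' t) \<in> H"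
      using eqD[OF that(1), of "Eq (?up (Add s t)) (Add (Var 0) (?up t))"] proves.eq_refl
      by (simp add: inst_o_def unshift closed[symmetric])
    then show ?thesis
      using eqD[OF that(2), of "Eq (?up (Add s t)) (Add (?up s') (Var 0))"]
      by (simp add: inst_o_def unshift qo(2))
  qed
  have Mul: "qo (Mul s t) = qo (Mul s' t')" if "qo s = qo s'" "qo t = qo t'" for s t s' t'
  proof -
    have "Eq (Mul s t) (Mul s' t) \<in> H"
      using eqD[OF that(1), of "Eq (?up (Mul s t)) (Mul (Var 0) (?up t))"] proves.eq_refl
      by (simp add: inst_o_def unshift closed[symmetric])
    then show ?thesis
      using eqD[OF that(2), of "Eq (?up (Mul s t)) (Mul (?up s') (Var 0))"]
      by (simp add: inst_o_def unshift qo(2))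
  qed
  have Mem: "Mem s' X' \<in> H" if "qo s = qo s'" "qc X = qc X'" "Mem s X \<in> H" for s X s' X'
  proof -
    have "Mem s' X \<in> H"
      using eqD[OF that(1), of "Mem (Var 0) X"] that(3) by (simp add: inst_o_def)
    then show ?thesis
      using eqCD[OF that(2), of "Mem s' 0"] by (simp add: inst_c_def)
  qed
  define lt where "lt = (\<lambda>x y. \<exists>s t. qo s = x \<and> qo t = y \<and> Less s t \<in> H)"
  define mem where "mem = (\<lambda>x X. \<exists>s Y. qo s = x \<and> qc Y = X \<and> Mem s Y \<in> H)"
  \<comment> \<open>A representative is chosen by \<open>inv qo\<close>; by \<open>Add\<close> the
    class of the result does not depend on it.\<close>
  define ad where "ad = (\<lambda>x y. qo (Add (inv qo x) (inv qo y)))"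
  define mu where "mu = (\<lambda>x y. qo (Mul (inv qo x) (inv qo y)))"
  interpret M: two_sorted lt ad mu mem .
  have inv: "qo (inv qo x) = x" for x using qo(1) by (simp add: surj_f_inv_f)
  have lt: "lt (qo s) (qo t) \<longleftrightarrow> Less s t \<in> H" for s t using Less unfolding lt_def by blast
  have mem: "mem (qo s) (qc X) \<longleftrightarrow> Mem s X \<in> H" for s X using Mem unfolding mem_def by blast
  have ad: "ad (qo s) (qo t) = qo (Add s t)" for s t unfolding ad_def by (intro Add inv)
  have mu: "mu (qo s) (qo t) = qo (Mul s t)" for s t unfolding mu_def by (intro Mul inv)
  have tval: "M.tval (\<lambda>i. qo (\<sigma> i)) t = qo (tsubst \<sigma> t)" for \<sigma> t
    by (induction t) (auto simp: ad mu)
  have imp: "Imp \<phi> \<psi> \<in> H \<longleftrightarrow> (\<phi> \<in> H \<longrightarrow> \<psi> \<in> H)" for \<phi> \<psi>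
  proof
    assume "Imp \<phi> \<psi> \<in> H"
    then show "\<phi> \<in> H \<longrightarrow> \<psi> \<in> H" using proves.impE[of H \<phi> \<psi>] by (simp add: closed)
  next
    assume r: "\<phi> \<in> H \<longrightarrow> \<psi> \<in> H"
    show "Imp \<phi> \<psi> \<in> H"
    proof (cases "\<psi> \<in> H")
      case True
      then show ?thesis using proves.impI proves.assm closed by blast
    next
      case False
      with r have "Imp \<phi> Falsum \<in> H" by (auto intro: neg)
      then have "insert (Imp \<psi> Falsum) (insert \<phi> H) \<turnstile> Falsum"
        by (intro proves.impE[of _ \<phi> Falsum, OF proves.assm proves.assm]) auto
      then have "H \<turnstile> Imp \<phi> \<psi>" by (intro proves.impI[OF proves.contr])
      then show ?thesis by (simp add: closed)
    qed
  qed
  have "M.sat (\<lambda>i. qo (\<sigma> i)) (\<lambda>j. qc (\<tau> j)) \<phi> \<longleftrightarrow> fsubst \<sigma> \<tau> \<phi> \<in> H" for \<phi> \<sigma> \<tau>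
  proof (induction \<phi> arbitrary: \<sigma> \<tau>)
    case (All \<phi>)
    have eq: "inst_o t (fsubst (lift_o \<sigma>) \<tau> \<phi>) = fsubst (case_nat t \<sigma>) \<tau> \<phi>" for t
      unfolding inst_o_def fsubst_fsubst
      by (intro arg_cong2[of _ _ _ _ "\<lambda>a b. fsubst a b \<phi>"])
         (auto simp: fun_eq_iff lift_o_def unshift split: nat.split)
    have cn: "case_nat (qo t) (\<lambda>i. qo (\<sigma> i)) = (\<lambda>i. qo (case_nat t \<sigma> i))" for t
      by (auto simp: fun_eq_iff split: nat.split)
    have "M.sat (\<lambda>i. qo (\<sigma> i)) (\<lambda>j. qc (\<tau> j)) (All \<phi>) \<longleftrightarrow>
        (\<forall>t. M.sat (case_nat (qo t) (\<lambda>i. qo (\<sigma> i))) (\<lambda>j. qc (\<tau> j)) \<phi>)"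
      using surjD[OF qo(1)] by simp metis
    also have "\<dots> \<longleftrightarrow> (\<forall>t. inst_o t (fsubst (lift_o \<sigma>) \<tau> \<phi>) \<in> H)"
      by (simp only: cn eq All.IH)
    also have "\<dots> \<longleftrightarrow> All (fsubst (lift_o \<sigma>) \<tau> \<phi>) \<in> H"
      using wit(1) closed proves.allE by blast
    finally show ?case by simp
  next
    case (AllC \<phi>)
    have eq: "inst_c k (fsubst \<sigma> (lift_c \<tau>) \<phi>) = fsubst \<sigma> (case_nat k \<tau>) \<phi>" for k
      unfolding inst_c_def fsubst_fsubst
      by (intro arg_cong2[of _ _ _ _ "\<lambda>a b. fsubst a b \<phi>"])
         (auto simp: fun_eq_iff lift_c_def split: nat.split)
    have cn: "case_nat (qc k) (\<lambda>i. qc (\<tau> i)) = (\<lambda>i. qc (case_nat k \<tau> i))" for k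
      by (auto simp: fun_eq_iff split: nat.split)
    have "M.sat (\<lambda>i. qo (\<sigma> i)) (\<lambda>j. qc (\<tau> j)) (AllC \<phi>) \<longleftrightarrow>
        (\<forall>k. M.sat (\<lambda>i. qo (\<sigma> i)) (case_nat (qc k) (\<lambda>j. qc (\<tau> j))) \<phi>)"
      using surjD[OF qc(1)] by simp metis
    also have "\<dots> \<longleftrightarrow> (\<forall>k. inst_c k (fsubst \<sigma> (lift_c \<tau>) \<phi>) \<in> H)"
      by (simp only: cn eq AllC.IH)
    also have "\<dots> \<longleftrightarrow> AllC (fsubst \<sigma> (lift_c \<tau>) \<phi>) \<in> H"
      using wit(2) closed proves.allCE by blast
    finally show ?case by simp
  next
    case Falsum
    then show ?case using con by (simp add: closed)
  qed (auto simp: tval lt mem imp qo(2) qc(2))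
  then show ?thesis by blast
qed

section \<open>Evaluating formulas with named binders\<close>

text \<open>This is the argument that \<open>all_f\<close> passes to its body at depth
  \<open>l\<close>. Evaluating a formula with named binders therefore only meets variables of this
  shape.\<close>

definition lvl :: "nat \<Rightarrow> otm" where
  "lvl l = (\<lambda>d. Var (d - Suc l))"

definition clvl :: "nat \<Rightarrow> ctm" where
  "clvl l = (\<lambda>e. e - Suc l)"

text \<open>A list \<open>vs\<close> gives the values of the bound variables by de Bruijn level, the outermost first;
  \<open>env \<rho> vs\<close> is the corresponding environment for de Bruijn indices.\<close>

definition env :: "(nat \<Rightarrow> 'a) \<Rightarrow> 'a list \<Rightarrow> nat \<Rightarrow> 'a" where
  "env \<rho> vs i = (if i < length vs then vs ! (length vs - Suc i) else \<rho> (i - length vs))"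

lemma env_Nil [simp]: "env \<rho> [] = \<rho>"
  by (auto simp: env_def)

lemma env_snoc: "env \<rho> (vs @ [x]) = case_nat x (env \<rho> vs)"
  by (auto simp: fun_eq_iff env_def nth_append split: nat.split)

text \<open>Removing the outermost quantifier of a closure changes the base assignment, whereas
  \<open>env_snoc\<close> describes entering an innermost binder.\<close>

lemma env_Cons: "env \<rho> (x # vs) = env (case_nat x \<rho>) vs"
proof
  fix i
  consider "i < length vs" | "i = length vs" | k where "i = Suc (length vs + k)"
    by (metis add_Suc_right less_imp_Suc_add linorder_neqE_nat)
  then show "env \<rho> (x # vs) i = env (case_nat x \<rho>) vs i"
    by cases (auto simp: env_def nth_Cons' Suc_diff_Suc)
qed

text \<open>The assignment that \<open>app\<close> induces for a schematic formula: the listed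
  arguments first, the parameters after them.\<close>

definition pre :: "'a list \<Rightarrow> (nat \<Rightarrow> 'a) \<Rightarrow> nat \<Rightarrow> 'a" where
  "pre xs \<rho> = (\<lambda>i. if i < length xs then xs ! i else \<rho> (i - length xs))"

lemma pre_simps [simp]: "pre [] \<rho> = \<rho>" "pre (x # xs) \<rho> = case_nat x (pre xs \<rho>)"
  by (auto simp: pre_def fun_eq_iff split: nat.split)

locale interp = two_sorted lt ad mu mem
  for lt :: "'o \<Rightarrow> 'o \<Rightarrow> bool" and ad mu :: "'o \<Rightarrow> 'o \<Rightarrow> 'o" and mem :: "'o \<Rightarrow> 'c \<Rightarrow> bool" +
  fixes \<rho>0 :: "nat \<Rightarrow> 'o" and \<kappa>0 :: "nat \<Rightarrow> 'c"
begin

definition T :: "otm \<Rightarrow> 'o list \<Rightarrow> 'o" where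
  "T x vs = tval (env \<rho>0 vs) (x (length vs))"

definition TC :: "ctm \<Rightarrow> 'c list \<Rightarrow> 'c" where
  "TC X ws = env \<kappa>0 ws (X (length ws))"

definition S :: "form \<Rightarrow> 'o list \<Rightarrow> 'c list \<Rightarrow> bool" where
  "S F vs ws \<longleftrightarrow> sat (env \<rho>0 vs) (env \<kappa>0 ws) (F (length vs) (length ws))"

lemma T_lvl [simp]: "l < length vs \<Longrightarrow> T (lvl l) vs = vs ! l"
  by (auto simp: T_def lvl_def env_def Suc_diff_Suc diff_less)

lemma TC_clvl [simp]: "l < length ws \<Longrightarrow> TC (clvl l) ws = ws ! l"
  by (auto simp: TC_def clvl_def env_def Suc_diff_Suc diff_less)

lemma T_ops [simp]:
  "T (x \<^bold>+ y) vs = ad (T x vs) (T y vs)"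
  "T (x \<^bold>\<times> y) vs = mu (T x vs) (T y vs)"
  by (simp_all add: T_def add_o_def mul_o_def)

lemma S_prim [simp]:
  "S (x \<^bold>< y) vs ws \<longleftrightarrow> lt (T x vs) (T y vs)"
  "S (x \<^bold>= y) vs ws \<longleftrightarrow> T x vs = T y vs"
  "S (x \<^bold>\<in> X) vs ws \<longleftrightarrow> mem (T x vs) (TC X ws)"
  "S (X \<^bold>=\<^sub>c Y) vs ws \<longleftrightarrow> TC X ws = TC Y ws"
  "S \<^bold>\<bottom> vs ws \<longleftrightarrow> False"
  "S (F \<^bold>\<longrightarrow> G) vs ws \<longleftrightarrow> (S F vs ws \<longrightarrow> S G vs ws)"
  by (simp_all add: S_def T_def TC_def less_f_def eq_f_def mem_f_def eqC_f_def false_f_def imp_f_def)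

lemma S_all [simp]:
  "S (all_f H) vs ws \<longleftrightarrow> (\<forall>x. S (H (lvl (length vs))) (vs @ [x]) ws)"
  "S (allC_f K) vs ws \<longleftrightarrow> (\<forall>X. S (K (clvl (length ws))) vs (ws @ [X]))"
  by (simp_all add: S_def all_f_def allC_f_def env_snoc lvl_def clvl_def)

lemma S_derived [simp]:
  "S (\<^bold>\<not> F) vs ws \<longleftrightarrow> \<not> S F vs ws"
  "S (F \<^bold>\<and> G) vs ws \<longleftrightarrow> S F vs ws \<and> S G vs ws"
  "S (F \<^bold>\<or> G) vs ws \<longleftrightarrow> S F vs ws \<or> S G vs ws"
  "S (F \<^bold>\<longleftrightarrow> G) vs ws \<longleftrightarrow> (S F vs ws \<longleftrightarrow> S G vs ws)"
  "S (ex_f H) vs ws \<longleftrightarrow> (\<exists>x. S (H (lvl (length vs))) (vs @ [x]) ws)"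
  "S (exC_f K) vs ws \<longleftrightarrow> (\<exists>X. S (K (clvl (length ws))) vs (ws @ [X]))"
  by (auto simp: not_f_def and_f_def or_f_def iff_f_def ex_f_def exC_f_def)

lemma S_ex1 [simp]:
  "S (ex1_f H) vs ws \<longleftrightarrow> (\<exists>x. S (H (lvl (length vs))) (vs @ [x]) ws \<and>
     (\<forall>y. S (H (lvl (Suc (length vs)))) (vs @ [x, y]) ws \<longrightarrow> y = x))"
  by (simp add: ex1_f_def nth_append)

section \<open>Closures and schematic formulas\<close>

lemma sat_All_funpow:
  "sat \<rho> \<kappa> ((All ^^ p) \<phi>) \<longleftrightarrow> (\<forall>vs. length vs = p \<longrightarrow> sat (env \<rho> vs) \<kappa> \<phi>)"
proof (induction p arbitrary: \<rho>)
  case (Suc p)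
  have "sat \<rho> \<kappa> ((All ^^ Suc p) \<phi>) \<longleftrightarrow>
      (\<forall>x vs. length vs = p \<longrightarrow> sat (env \<rho> (x # vs)) \<kappa> \<phi>)"
    by (simp add: Suc.IH env_Cons)
  also have "\<dots> \<longleftrightarrow> (\<forall>vs. length vs = Suc p \<longrightarrow> sat (env \<rho> vs) \<kappa> \<phi>)"
    by (metis length_Suc_conv)
  finally show ?case .
qed simp

lemma sat_AllC_funpow:
  "sat \<rho> \<kappa> ((AllC ^^ q) \<phi>) \<longleftrightarrow> (\<forall>ws. length ws = q \<longrightarrow> sat \<rho> (env \<kappa> ws) \<phi>)"
proof (induction q arbitrary: \<kappa>)
  case (Suc q)
  have "sat \<rho> \<kappa> ((AllC ^^ Suc q) \<phi>) \<longleftrightarrow>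
      (\<forall>X ws. length ws = q \<longrightarrow> sat \<rho> (env \<kappa> (X # ws)) \<phi>)"
    by (simp add: Suc.IH env_Cons)
  also have "\<dots> \<longleftrightarrow> (\<forall>ws. length ws = Suc q \<longrightarrow> sat \<rho> (env \<kappa> ws) \<phi>)"
    by (metis length_Suc_conv)
  finally show ?case .
qed simp

lemma sat_closure:
  "sat \<rho>0 \<kappa>0 (closure p q F) \<longleftrightarrow> (\<forall>vs ws. length vs = p \<longrightarrow> length ws = q \<longrightarrow> S F vs ws)"
  by (auto simp: closure_def sat_All_funpow sat_AllC_funpow S_def)

lemma sat_sentence: "sat \<rho>0 \<kappa>0 (sentence F) \<longleftrightarrow> S F [] []"
  by (simp add: sentence_def sat_closure)

text \<open>The parameters of a schematic formula are the outermost levels. Hence an arbitrary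
  assignment is fed into a closure as the list of its first values, and \<open>fm_below\<close>
  guarantees that no later value is consulted.\<close>

lemma S_app:
  assumes "fm_below (length xs + p) (length Xs + q) \<phi>"
  shows "S (app \<phi> xs Xs) (map \<rho> [0..<p] @ vs) (map \<kappa> [0..<q] @ ws) \<longleftrightarrow>
    sat (pre (map (\<lambda>x. T x (map \<rho> [0..<p] @ vs)) xs) \<rho>)
        (pre (map (\<lambda>X. TC X (map \<kappa> [0..<q] @ ws)) Xs) \<kappa>) \<phi>"
  unfolding S_def app_def sat_fsubst
  by (rule sat_cong_below[OF assms]) (auto simp: pre_def T_def TC_def env_def nth_append)

section \<open>Semantic counterparts of the defined notions\<close>

definition axs :: "'o \<Rightarrow> 'o \<Rightarrow> 'o" where
  "axs a b = ad (mu (ad a b) (ad a b)) a"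

lemma T_aux [simp]: "T (aux x y) vs = axs (T x vs) (T y vs)"
  by (simp add: aux_def axs_def)

definition le :: "'o \<Rightarrow> 'o \<Rightarrow> bool" where
  "le x y \<longleftrightarrow> lt x y \<or> x = y"

lemma S_le [simp]: "S (x \<^bold>\<le> y) vs ws \<longleftrightarrow> le (T x vs) (T y vs)"
  by (simp add: le_f_def le_def)

definition aux_rel :: "'c \<Rightarrow> 'o \<Rightarrow> 'o \<Rightarrow> 'o \<Rightarrow> bool" where
  "aux_rel R a b c \<longleftrightarrow> mem (axs (axs a b) c) R"

lemma S_aux_mem [simp]:
  "S (aux_mem x y z R) vs ws \<longleftrightarrow> aux_rel (TC R ws) (T x vs) (T y vs) (T z vs)"
  by (simp add: aux_mem_def aux_rel_def)

definition goedel_lt :: "'o \<Rightarrow> 'o \<Rightarrow> 'o \<Rightarrow> 'o \<Rightarrow> bool" where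
  "goedel_lt a b a' b' \<longleftrightarrow> (\<exists>m m'. (le b a \<and> m = a \<or> le a b \<and> m = b) \<and>
     (le b' a' \<and> m' = a' \<or> le a' b' \<and> m' = b') \<and>
     (lt m m' \<or> m = m' \<and> (lt a a' \<or> a = a' \<and> lt b b')))"

definition goedel_iso :: "('o \<Rightarrow> 'o \<Rightarrow> 'o \<Rightarrow> bool) \<Rightarrow> bool" where
  "goedel_iso R \<longleftrightarrow> (\<forall>a b. \<exists>!c. R a b c) \<and> (\<forall>c. \<exists>a b. R a b c) \<and>
     (\<forall>a b c a' b' c'. R a b c \<and> R a' b' c' \<longrightarrow> (goedel_lt a b a' b' \<longleftrightarrow> lt c c'))"

definition pair :: "'o \<Rightarrow> 'o \<Rightarrow> 'o \<Rightarrow> bool" where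
  "pair a b c \<longleftrightarrow> (\<exists>R. goedel_iso (aux_rel R) \<and> aux_rel R a b c)"

definition pairm :: "'o \<Rightarrow> 'o \<Rightarrow> 'c \<Rightarrow> bool" where
  "pairm a b X \<longleftrightarrow> (\<exists>c. pair a b c \<and> mem c X)"

definition sec :: "'c \<Rightarrow> 'o \<Rightarrow> 'c \<Rightarrow> bool" where
  "sec C a D \<longleftrightarrow> (\<forall>b. mem b D \<longleftrightarrow> pairm a b C)"

definition bdd :: "'c \<Rightarrow> 'o \<Rightarrow> bool" where
  "bdd X a \<longleftrightarrow> (\<forall>b. mem b X \<longrightarrow> lt b a)"

definition seq :: "'c \<Rightarrow> 'o \<Rightarrow> bool" where
  "seq Q a \<longleftrightarrow> (\<forall>z. mem z Q \<longrightarrow> (\<exists>b c. lt b a \<and> pair b c z))"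

definition restr :: "'c \<Rightarrow> 'o \<Rightarrow> 'c \<Rightarrow> bool" where
  "restr P a Q \<longleftrightarrow> (\<forall>z. mem z Q \<longleftrightarrow> mem z P \<and> (\<exists>b c. lt b a \<and> pair b c z))"

lemma S_is_max [simp]:
  assumes "i < length vs" "j < length vs" "k < length vs"
  shows "S (is_max (lvl i) (lvl j) (lvl k)) vs ws \<longleftrightarrow>
     (le (vs ! j) (vs ! i) \<and> vs ! k = vs ! i \<or> le (vs ! i) (vs ! j) \<and> vs ! k = vs ! j)"
  using assms by (simp add: is_max_def)

lemma S_goedel_less [simp]:
  assumes "i < length vs" "j < length vs" "k < length vs" "l < length vs"
  shows "S (goedel_less (lvl i) (lvl j) (lvl k) (lvl l)) vs ws \<longleftrightarrow>
     goedel_lt (vs ! i) (vs ! j) (vs ! k) (vs ! l)"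
  using assms by (simp add: goedel_less_def goedel_lt_def nth_append)

lemma S_is_goedel_iso [simp]:
  assumes "i < length ws"
  shows "S (is_goedel_iso (clvl i)) vs ws \<longleftrightarrow> goedel_iso (aux_rel (ws ! i))"
  using assms by (simp add: is_goedel_iso_def goedel_iso_def nth_append Ex1_def)

lemma S_is_pair [simp]:
  assumes "i < length vs" "j < length vs" "k < length vs"
  shows "S (is_pair (lvl i) (lvl j) (lvl k)) vs ws \<longleftrightarrow> pair (vs ! i) (vs ! j) (vs ! k)"
  using assms by (simp add: is_pair_def pair_def nth_append)

lemma S_pair_mem [simp]:
  assumes "i < length vs" "j < length vs" "k < length ws"
  shows "S (pair_mem (lvl i) (lvl j) (clvl k)) vs ws \<longleftrightarrow> pairm (vs ! i) (vs ! j) (ws ! k)"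
  using assms by (simp add: pair_mem_def pairm_def nth_append)

lemma S_is_section [simp]:
  assumes "i < length ws" "j < length vs" "k < length ws"
  shows "S (is_section (clvl i) (lvl j) (clvl k)) vs ws \<longleftrightarrow> sec (ws ! i) (vs ! j) (ws ! k)"
  using assms by (simp add: is_section_def sec_def nth_append)

lemma S_bounded_by [simp]:
  assumes "i < length ws" "j < length vs"
  shows "S (bounded_by (clvl i) (lvl j)) vs ws \<longleftrightarrow> bdd (ws ! i) (vs ! j)"
  using assms by (simp add: bounded_by_def bdd_def nth_append)

lemma S_bounded_f [simp]:
  assumes "i < length ws"
  shows "S (bounded_f (clvl i)) vs ws \<longleftrightarrow> (\<exists>a. bdd (ws ! i) a)"
  using assms by (simp add: bounded_f_def nth_append)

lemma S_is_sequence [simp]: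
  assumes "i < length ws" "j < length vs"
  shows "S (is_sequence (clvl i) (lvl j)) vs ws \<longleftrightarrow> seq (ws ! i) (vs ! j)"
  using assms by (simp add: is_sequence_def seq_def nth_append)

lemma S_is_restriction [simp]:
  assumes "i < length ws" "j < length vs" "k < length ws"
  shows "S (is_restriction (clvl i) (lvl j) (clvl k)) vs ws \<longleftrightarrow> restr (ws ! i) (vs ! j) (ws ! k)"
  using assms by (simp add: is_restriction_def restr_def nth_append)

definition strict_order :: bool where
  "strict_order \<longleftrightarrow> (\<forall>x. \<not> lt x x) \<and> (\<forall>x y z. lt x y \<and> lt y z \<longrightarrow> lt x z) \<and>
     (\<forall>x y. lt x y \<or> x = y \<or> lt y x)"

lemma S_strict_linear [simp]: "S strict_linear vs ws \<longleftrightarrow> strict_order"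
  by (simp add: strict_linear_def strict_order_def nth_append)

definition ex_limit :: bool where
  "ex_limit \<longleftrightarrow> (\<exists>a. (\<exists>b. lt b a) \<and> (\<forall>b. lt b a \<longrightarrow> (\<exists>c. lt c a \<and> lt b c)))"

lemma S_limit_exists [simp]: "S limit_exists vs ws \<longleftrightarrow> ex_limit"
  by (simp add: limit_exists_def ex_limit_def nth_append)

definition triplem :: "'o \<Rightarrow> 'o \<Rightarrow> 'o \<Rightarrow> 'c \<Rightarrow> bool" where
  "triplem a b c C \<longleftrightarrow> (\<exists>p. pair b c p \<and> pairm a p C)"

lemma S_triple_mem [simp]:
  assumes "i < length vs" "j < length vs" "k < length vs" "l < length ws"
  shows "S (triple_mem (lvl i) (lvl j) (lvl k) (clvl l)) vs ws \<longleftrightarrow>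
    triplem (vs ! i) (vs ! j) (vs ! k) (ws ! l)"
  using assms by (simp add: triple_mem_def triplem_def nth_append)

text \<open>For the remaining notions only the fact matters that their truth value depends on nothing
  but the values of the arguments, so their semantics is taken from a canonical environment.\<close>

definition "zero_s a \<longleftrightarrow> S (is_zero (lvl 0)) [a] []"
definition "suc_s a b \<longleftrightarrow> S (is_suc (lvl 0) (lvl 1)) [a, b] []"
definition "nat_s a \<longleftrightarrow> S (is_nat (lvl 0)) [a] []"
definition "num_s k a \<longleftrightarrow> S (is_num k (lvl 0)) [a] []"
definition "code1_s k a b \<longleftrightarrow> S (code1 k (lvl 0) (lvl 1)) [a, b] []"
definition "code2_s k a b c \<longleftrightarrow> S (code2 k (lvl 0) (lvl 1) (lvl 2)) [a, b, c] []"
definition "term_s a \<longleftrightarrow> S (is_term (lvl 0)) [a] []"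
definition "atomic_s a \<longleftrightarrow> S (is_atomic (lvl 0)) [a] []"
definition "form_closed_s X \<longleftrightarrow> S (form_closed (clvl 0)) [] [X]"
definition "form_s a \<longleftrightarrow> S (is_form (lvl 0)) [a] []"
definition "lookup_s L \<longleftrightarrow> S (is_lookup (clvl 0)) [] [L]"
definition "var_val_s a b c \<longleftrightarrow> S (var_val (lvl 0) (lvl 1) (lvl 2)) [a, b, c] []"
definition "term_val_s a b c d \<longleftrightarrow> S (term_val (lvl 0) (lvl 1) (lvl 2) (lvl 3)) [a, b, c, d] []"
definition "same_ext_s E a b \<longleftrightarrow> S (same_ext (clvl 0) (lvl 0) (lvl 1)) [a, b] [E]"
definition "satisfaction_s E X \<longleftrightarrow> S (is_satisfaction (clvl 0) (clvl 1)) [] [E, X]"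
definition "truth_s E c s t \<longleftrightarrow> S (truth (clvl 0) (lvl 0) (lvl 1) (lvl 2)) [c, s, t] [E]"
definition "truth1_s E c a s t \<longleftrightarrow>
  S (truth1 (clvl 0) (lvl 0) (lvl 1) (lvl 2) (lvl 3)) [c, a, s, t] [E]"
definition "truth2_s E c a b s t \<longleftrightarrow>
  S (truth2 (clvl 0) (lvl 0) (lvl 1) (lvl 2) (lvl 3) (lvl 4)) [c, a, b, s, t] [E]"

lemma S_is_zero [simp]: "i < length vs \<Longrightarrow> S (is_zero (lvl i)) vs ws \<longleftrightarrow> zero_s (vs ! i)"
  by (simp add: zero_s_def is_zero_def nth_append)

lemma S_is_suc [simp]:
  "i < length vs \<Longrightarrow> j < length vs \<Longrightarrow>
   S (is_suc (lvl i) (lvl j)) vs ws \<longleftrightarrow> suc_s (vs ! i) (vs ! j)"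
  by (simp add: suc_s_def is_suc_def nth_append)

lemma S_is_nat [simp]: "i < length vs \<Longrightarrow> S (is_nat (lvl i)) vs ws \<longleftrightarrow> nat_s (vs ! i)"
  by (simp add: nat_s_def is_nat_def nth_append)

lemma S_is_num: "i < length vs \<Longrightarrow> S (is_num k (lvl i)) vs ws \<longleftrightarrow> num_s k (vs ! i)"
proof (induction k arbitrary: i vs ws)
  case 0
  then show ?case by (simp add: num_s_def)
next
  case (Suc k)
  then show ?case by (simp add: num_s_def[of "Suc k"] nth_append)
qed

lemma S_code1 [simp]:
  "i < length vs \<Longrightarrow> j < length vs \<Longrightarrow>
   S (code1 k (lvl i) (lvl j)) vs ws \<longleftrightarrow> code1_s k (vs ! i) (vs ! j)"
  by (simp add: code1_s_def code1_def S_is_num nth_append)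

lemma S_code2 [simp]:
  "i < length vs \<Longrightarrow> j < length vs \<Longrightarrow> l < length vs \<Longrightarrow>
   S (code2 k (lvl i) (lvl j) (lvl l)) vs ws \<longleftrightarrow> code2_s k (vs ! i) (vs ! j) (vs ! l)"
  by (simp add: code2_s_def code2_def nth_append)

lemma S_is_term [simp]: "i < length vs \<Longrightarrow> S (is_term (lvl i)) vs ws \<longleftrightarrow> term_s (vs ! i)"
  by (simp add: term_s_def is_term_def nth_append)

lemma S_is_atomic [simp]: "i < length vs \<Longrightarrow> S (is_atomic (lvl i)) vs ws \<longleftrightarrow> atomic_s (vs ! i)"
  by (simp add: atomic_s_def is_atomic_def nth_append)

lemma S_form_closed [simp]:
  "i < length ws \<Longrightarrow> S (form_closed (clvl i)) vs ws \<longleftrightarrow> form_closed_s (ws ! i)"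
  by (simp add: form_closed_s_def form_closed_def nth_append)

lemma S_is_form [simp]: "i < length vs \<Longrightarrow> S (is_form (lvl i)) vs ws \<longleftrightarrow> form_s (vs ! i)"
  by (simp add: form_s_def is_form_def nth_append)

lemma S_is_lookup [simp]: "i < length ws \<Longrightarrow> S (is_lookup (clvl i)) vs ws \<longleftrightarrow> lookup_s (ws ! i)"
  by (simp add: lookup_s_def is_lookup_def nth_append)

lemma S_var_val [simp]:
  "i < length vs \<Longrightarrow> j < length vs \<Longrightarrow> k < length vs \<Longrightarrow>
   S (var_val (lvl i) (lvl j) (lvl k)) vs ws \<longleftrightarrow> var_val_s (vs ! i) (vs ! j) (vs ! k)"
  by (simp add: var_val_s_def var_val_def nth_append)

lemma S_term_val [simp]:
  "i < length vs \<Longrightarrow> j < length vs \<Longrightarrow> k < length vs \<Longrightarrow> l < length vs \<Longrightarrow>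
   S (term_val (lvl i) (lvl j) (lvl k) (lvl l)) vs ws \<longleftrightarrow>
     term_val_s (vs ! i) (vs ! j) (vs ! k) (vs ! l)"
  by (simp add: term_val_s_def term_val_def nth_append)

lemma S_in_ext [simp]:
  "i < length vs \<Longrightarrow> j < length vs \<Longrightarrow> k < length ws \<Longrightarrow>
   S (in_ext (clvl k) (lvl i) (lvl j)) vs ws \<longleftrightarrow> pairm (vs ! i) (vs ! j) (ws ! k)"
  by (simp add: in_ext_def)

lemma S_same_ext [simp]:
  "i < length vs \<Longrightarrow> j < length vs \<Longrightarrow> k < length ws \<Longrightarrow>
   S (same_ext (clvl k) (lvl i) (lvl j)) vs ws \<longleftrightarrow> same_ext_s (ws ! k) (vs ! i) (vs ! j)"
  by (simp add: same_ext_s_def same_ext_def nth_append)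

lemma S_is_satisfaction [simp]:
  "i < length ws \<Longrightarrow> j < length ws \<Longrightarrow>
   S (is_satisfaction (clvl i) (clvl j)) vs ws \<longleftrightarrow> satisfaction_s (ws ! i) (ws ! j)"
  by (simp add: satisfaction_s_def is_satisfaction_def nth_append)

lemma S_truth [simp]:
  "e < length ws \<Longrightarrow> i < length vs \<Longrightarrow> j < length vs \<Longrightarrow> k < length vs \<Longrightarrow>
   S (truth (clvl e) (lvl i) (lvl j) (lvl k)) vs ws \<longleftrightarrow>
     truth_s (ws ! e) (vs ! i) (vs ! j) (vs ! k)"
  by (simp add: truth_s_def truth_def nth_append)

lemma S_truth1 [simp]:
  "e < length ws \<Longrightarrow> i < length vs \<Longrightarrow> j < length vs \<Longrightarrow> k < length vs \<Longrightarrow> l < length vs \<Longrightarrow>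
   S (truth1 (clvl e) (lvl i) (lvl j) (lvl k) (lvl l)) vs ws \<longleftrightarrow>
     truth1_s (ws ! e) (vs ! i) (vs ! j) (vs ! k) (vs ! l)"
  by (simp add: truth1_s_def truth1_def nth_append)

lemma S_truth2 [simp]:
  "e < length ws \<Longrightarrow> i < length vs \<Longrightarrow> j < length vs \<Longrightarrow> k < length vs \<Longrightarrow> l < length vs \<Longrightarrow>
   m < length vs \<Longrightarrow> S (truth2 (clvl e) (lvl i) (lvl j) (lvl k) (lvl l) (lvl m)) vs ws \<longleftrightarrow>
     truth2_s (ws ! e) (vs ! i) (vs ! j) (vs ! k) (vs ! l) (vs ! m)"
  by (simp add: truth2_s_def truth2_def nth_append)

definition sup_of :: "('o \<Rightarrow> bool) \<Rightarrow> 'o \<Rightarrow> bool" where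
  "sup_of P x \<longleftrightarrow> (\<forall>a. P a \<longrightarrow> le a x) \<and> (\<forall>y. (\<forall>a. P a \<longrightarrow> le a y) \<longrightarrow> le x y)"

definition reg_encoding :: "'c \<Rightarrow> bool" where
  "reg_encoding E \<longleftrightarrow>
     (\<forall>x y. (\<forall>b. pairm b x E \<longleftrightarrow> pairm b y E) \<longrightarrow> x = y) \<and> strict_order \<and>
     (\<forall>x. (\<exists>a. pairm a x E) \<longrightarrow> (\<exists>a. pairm a x E \<and> (\<forall>b. pairm b x E \<longrightarrow> le a b))) \<and>
     (\<forall>c s t. form_s c \<longrightarrow> (\<forall>\<alpha>. (\<forall>\<gamma>. lt \<gamma> \<alpha> \<longrightarrow> (\<exists>!\<delta>. truth2_s E c \<gamma> \<delta> s t)) \<longrightarrow>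
        (\<exists>\<beta>. \<forall>\<gamma>. lt \<gamma> \<alpha> \<longrightarrow> (\<exists>\<delta>. lt \<delta> \<beta> \<and> truth2_s E c \<gamma> \<delta> s t)))) \<and>
     (\<forall>x. \<exists>a. \<forall>b. pairm b x E \<longrightarrow> lt b a) \<and>
     (\<forall>c s t. form_s c \<longrightarrow> (\<forall>\<alpha>. \<exists>x. \<forall>b. pairm b x E \<longleftrightarrow> lt b \<alpha> \<and> truth1_s E c b s t)) \<and>
     (\<forall>x a. pairm a x E \<longrightarrow> lt a x) \<and> ex_limit \<and>
     (\<forall>x y \<sigma> \<tau>. sup_of (\<lambda>a. pairm a x E) \<sigma> \<and> sup_of (\<lambda>a. pairm a y E) \<tau> \<and> lt \<sigma> \<tau> \<longrightarrow> lt x y)"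

lemma S_is_reg_encoding [simp]:
  "i < length ws \<Longrightarrow> S (is_reg_encoding (clvl i)) vs ws \<longleftrightarrow> reg_encoding (ws ! i)"
  unfolding is_reg_encoding_def reg_encoding_def
  by (simp add: same_ext_def has_least_def replacement_f_def is_sup_def sup_of_def
      nth_append Ex1_def del: S_same_ext)

lemma S_encoded_in [simp]:
  "i < length ws \<Longrightarrow> j < length ws \<Longrightarrow>
   S (encoded_in (clvl i) (clvl j)) vs ws \<longleftrightarrow>
     (\<exists>a. \<forall>b. mem b (ws ! i) \<longleftrightarrow> pairm b a (ws ! j))"
  by (simp add: encoded_in_def nth_append)

end

section \<open>The enumeration of the bounded classes\<close>

locale mc_model = interp lt ad mu mem \<rho>0 \<kappa>0
  for lt :: "'o \<Rightarrow> 'o \<Rightarrow> bool" and ad mu :: "'o \<Rightarrow> 'o \<Rightarrow> 'o" and mem :: "'o \<Rightarrow> 'c \<Rightarrow> bool"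
    and \<rho>0 \<kappa>0 +
  assumes ax: "\<phi> \<in> MC_A \<Longrightarrow> sat \<rho>0 \<kappa>0 \<phi>"
begin

section \<open>The axioms and schemata in the model\<close>

lemma S_closure:
  assumes "closure p q F \<in> MC_A"
  shows "S F (map \<rho> [0..<p]) (map \<kappa> [0..<q])"
  using ax[OF assms] by (simp add: sat_closure)

lemma S_sentence: "sentence F \<in> MC_A \<Longrightarrow> S F [] []"
  using ax sat_sentence by blast

text \<open>A formula has finitely many free variables, so a closure with enough quantifiers covers
  all parameters and the schema holds under every assignment. The other schemata are treated
  alike.\<close>

lemma sat_comprehension: "\<exists>X. \<forall>a. mem a X \<longleftrightarrow> sat (case_nat a \<rho>) \<kappa> \<phi>"
proof -
  obtain n where n: "fm_below n n \<phi>" using ex_fm_below by blast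
  then have 1: "fm_below (1 + n) n \<phi>" by (rule fm_below_mono) auto
  then have "closure n n (\<^bold>\<exists>\<^sub>cX. \<^bold>\<forall>\<alpha>. \<alpha> \<^bold>\<in> X \<^bold>\<longleftrightarrow> app \<phi> [\<alpha>] []) \<in> MC_A"
    unfolding MC_A_def OA_def comprehension_axioms_def by blast
  from S_closure[OF this, of \<rho> \<kappa>] show ?thesis
    using 1 by (simp add: S_app nth_append)
qed

lemma sat_replacement:
  assumes "\<forall>\<gamma>. lt \<gamma> \<alpha> \<longrightarrow> (\<exists>!\<delta>. sat (case_nat \<gamma> (case_nat \<delta> \<rho>)) \<kappa> \<phi>)"
  shows "\<exists>\<beta>. \<forall>\<gamma>. lt \<gamma> \<alpha> \<longrightarrow> (\<exists>\<delta>. lt \<delta> \<beta> \<and> sat (case_nat \<gamma> (case_nat \<delta> \<rho>)) \<kappa> \<phi>)"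
proof -
  obtain n where n: "fm_below n n \<phi>" using ex_fm_below by blast
  then have 1: "fm_below (2 + n) n \<phi>" by (rule fm_below_mono) auto
  then have "closure n n (replacement_f (\<lambda>\<gamma> \<delta>. app \<phi> [\<gamma>, \<delta>] [])) \<in> MC_A"
    unfolding MC_A_def OA_def replacement_axioms_def by blast
  from S_closure[OF this, of \<rho> \<kappa>] assms show ?thesis
    \<comment> \<open>\<open>S_app\<close> expects a list of classes bound after the parameters. It
      is empty, because \<open>replacement_f\<close> has no class quantifier.\<close>
    using 1 S_app[where ws = "[]"] by (simp add: replacement_f_def Ex1_def nth_append)
qed

lemma sat_tdc:
  assumes "\<forall>\<alpha> Q. seq Q \<alpha> \<longrightarrow>
     ((\<exists>X. sat (case_nat \<alpha> \<rho>) (case_nat X (case_nat Q \<kappa>)) \<phi>) \<longleftrightarrow>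
      (\<forall>\<beta>. lt \<beta> \<alpha> \<longrightarrow> (\<forall>X R. sec Q \<beta> X \<and> restr Q \<beta> R \<longrightarrow>
         sat (case_nat \<beta> \<rho>) (case_nat X (case_nat R \<kappa>)) \<phi>)))"
  shows "\<exists>P. \<forall>\<alpha> X R. sec P \<alpha> X \<and> restr P \<alpha> R \<longrightarrow>
     sat (case_nat \<alpha> \<rho>) (case_nat X (case_nat R \<kappa>)) \<phi>"
proof -
  obtain n where n: "fm_below n n \<phi>" using ex_fm_below by blast
  then have 1: "fm_below (1 + n) (2 + n) \<phi>" by (rule fm_below_mono) auto
  then have "closure n n (tdc_f (\<lambda>\<alpha> X Q. app \<phi> [\<alpha>] [X, Q])) \<in> MC_A"
    unfolding MC_A_def TDC_def by blast
  from S_closure[OF this, of \<rho> \<kappa>] assms show ?thesis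
    using 1 by (simp add: tdc_f_def S_app nth_append)
qed

lemma sat_ue:
  assumes "\<forall>D. sat \<rho> (case_nat D \<kappa>) \<phi> \<longrightarrow> bdd D \<alpha>"
  shows "\<exists>C. (\<exists>\<beta>. bdd C \<beta>) \<and>
    (\<forall>D. sat \<rho> (case_nat D \<kappa>) \<phi> \<and> (\<exists>b. mem b D) \<longrightarrow> (\<exists>!\<xi>. sec C \<xi> D))"
proof -
  obtain n where n: "fm_below n n \<phi>" using ex_fm_below by blast
  then have 1: "fm_below n (1 + n) \<phi>" by (rule fm_below_mono) auto
  then have "closure n n (ue_f (\<lambda>D. app \<phi> [] [D])) \<in> MC_A"
    unfolding MC_A_def UE_def by blast
  from S_closure[OF this, of \<rho> \<kappa>] assms show ?thesis
    using 1 S_app[where vs = "[]"]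
    by (auto simp: ue_f_def uniformly_bounded_def encodes_hyperclass_def S_app nth_append Ex1_def)
qed


lemma comprehension: "\<exists>X. \<forall>a. mem a X \<longleftrightarrow> S F (vs @ [a]) ws"
  using sat_comprehension by (simp add: S_def env_snoc)

text \<open>The value \<open>\<delta>\<close> precedes the argument \<open>\<gamma>\<close> in the
  list: \<open>\<gamma>\<close> has index 0 in the schematic formula, and index 0 is the innermost
  level.\<close>

lemma replacement:
  assumes "\<And>\<gamma>. lt \<gamma> \<alpha> \<Longrightarrow> \<exists>!\<delta>. S F (vs @ [\<delta>, \<gamma>]) ws"
  obtains \<beta> where "\<And>\<gamma>. lt \<gamma> \<alpha> \<Longrightarrow> \<exists>\<delta>. lt \<delta> \<beta> \<and> S F (vs @ [\<delta>, \<gamma>]) ws"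
proof -
  have eq: "S F (vs @ [\<delta>, \<gamma>]) ws \<longleftrightarrow>
      sat (case_nat \<gamma> (case_nat \<delta> (env \<rho>0 vs))) (env \<kappa>0 ws) (F (length vs + 2) (length ws))" for \<gamma> \<delta>
    using env_snoc[of \<rho>0 "vs @ [\<delta>]" \<gamma>] by (simp add: S_def env_snoc)
  show ?thesis
    using that sat_replacement[of \<alpha> "env \<rho>0 vs" "env \<kappa>0 ws" "F (length vs + 2) (length ws)"] assms
    unfolding eq by blast
qed

lemma tdc:
  assumes "\<And>\<alpha> Q. seq Q \<alpha> \<Longrightarrow> (\<exists>X. S F [\<alpha>] [Q, X]) \<longleftrightarrow>
      (\<forall>\<beta>. lt \<beta> \<alpha> \<longrightarrow> (\<forall>X R. sec Q \<beta> X \<and> restr Q \<beta> R \<longrightarrow> S F [\<beta>] [R, X]))"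
  obtains P where "\<And>\<alpha> X R. sec P \<alpha> X \<Longrightarrow> restr P \<alpha> R \<Longrightarrow> S F [\<alpha>] [R, X]"
proof -
  have "S F [\<alpha>] [Q, X] \<longleftrightarrow> sat (case_nat \<alpha> \<rho>0) (case_nat X (case_nat Q \<kappa>0)) (F 1 2)" for \<alpha> Q X
    by (simp add: S_def env_Cons numeral_2_eq_2)
  then show ?thesis using sat_tdc[of \<rho>0 \<kappa>0 "F 1 2"] assms that by simp blast
qed

lemma uniform_encodability:
  obtains C \<beta> where "bdd C \<beta>" "\<And>D b. bdd D \<alpha> \<Longrightarrow> mem b D \<Longrightarrow> \<exists>\<xi>. sec C \<xi> D"
proof -
  let ?F = "bounded_by (clvl 0) (lvl 0)"
  have "sat (case_nat \<alpha> \<rho>0) (case_nat D \<kappa>0) (?F 1 1) \<longleftrightarrow> bdd D \<alpha>" for D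
    using S_bounded_by[of 0 "[D]" 0 "[\<alpha>]"] by (simp add: S_def env_Cons del: S_bounded_by)
  with sat_ue[of "case_nat \<alpha> \<rho>0" \<kappa>0 "?F 1 1" \<alpha>]
  obtain C \<beta> where C: "bdd C \<beta>" "\<And>D. bdd D \<alpha> \<and> (\<exists>b. mem b D) \<Longrightarrow> \<exists>!\<xi>. sec C \<xi> D"
    by metis
  show ?thesis by (rule that[OF C(1)]) (use C(2) in blast)
qed

lemma extensionality: "(\<And>a. mem a X \<longleftrightarrow> mem a Y) \<Longrightarrow> X = Y"
  using S_sentence[of "\<^bold>\<forall>\<^sub>cX. \<^bold>\<forall>\<^sub>cY. (\<^bold>\<forall>\<alpha>. \<alpha> \<^bold>\<in> X \<^bold>\<longleftrightarrow> \<alpha> \<^bold>\<in> Y) \<^bold>\<longrightarrow> X \<^bold>=\<^sub>c Y"]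
  unfolding MC_A_def OA_def extensionality_axiom_def by simp

lemma strict_order: strict_order
  using S_sentence[of strict_linear] unfolding MC_A_def OA_def order_axioms_def by simp

lemma ex_limit: ex_limit
  using S_sentence[of limit_exists] unfolding MC_A_def OA_def order_axioms_def by simp

sublocale ord: linorder le lt
  using strict_order unfolding strict_order_def le_def by unfold_locales blast+

lemma least_mem: "mem a X \<Longrightarrow> \<exists>m. mem m X \<and> (\<forall>b. mem b X \<longrightarrow> le m b)"
  using S_sentence[of "\<^bold>\<forall>\<^sub>cX. has_least (\<lambda>\<alpha>. \<alpha> \<^bold>\<in> X)"]
  unfolding MC_A_def OA_def order_axioms_def by (auto simp: has_least_def)

text \<open>Well-foundedness is an axiom for classes; Comprehension extends it to formulas. All
  inductions below are least-counterexample arguments through this lemma.\<close>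

lemma least:
  assumes "S F (vs @ [a]) ws"
  obtains m where "S F (vs @ [m]) ws" "\<And>b. S F (vs @ [b]) ws \<Longrightarrow> le m b"
proof -
  obtain X where X: "\<forall>a. mem a X \<longleftrightarrow> S F (vs @ [a]) ws" using comprehension by blast
  then have "mem a X" using assms by blast
  from least_mem[OF this] X show ?thesis using that by blast
qed

section \<open>The Goedel pairing function in the model\<close>

lemma goedel_lt_total: "goedel_lt a b a' b' \<or> (a = a' \<and> b = b') \<or> goedel_lt a' b' a b"
proof -
  obtain m where m: "le b a \<and> m = a \<or> le a b \<and> m = b" using ord.linear by blast
  obtain m' where m': "le b' a' \<and> m' = a' \<or> le a' b' \<and> m' = b'" using ord.linear by blast
  consider "lt m m'" | "m = m'" | "lt m' m" using ord.less_linear by blast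
  then show ?thesis
  proof cases
    case 2
    then show ?thesis using m m' ord.less_linear[of a a'] ord.less_linear[of b b']
      unfolding goedel_lt_def by blast
  qed (use m m' in \<open>unfold goedel_lt_def, blast+\<close>)
qed

text \<open>Raising a component never lowers the maximum; if the maximum stays the same, the
  lexicographic comparison decides.\<close>

lemma goedel_lt_mono1:
  assumes "lt a a'"
  shows "goedel_lt a b a' b"
proof -
  have "goedel_lt a b a' b" if "le b a" "le b a'"
    using that assms unfolding goedel_lt_def by blast
  moreover have "goedel_lt a b a' b" if "le a b" "le b a'"
    using that assms ord.le_less unfolding goedel_lt_def by blast
  moreover have "goedel_lt a b a' b" if "le a b" "le a' b"
    using that assms unfolding goedel_lt_def by blast
  ultimately show ?thesis using assms ord.linear ord.less_imp_le ord.order.trans by blast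
qed

lemma goedel_lt_mono2:
  assumes "lt b b'"
  shows "goedel_lt a b a b'"
proof -
  have "goedel_lt a b a b'" if "le a b" "le a b'"
    using that assms unfolding goedel_lt_def by blast
  moreover have "goedel_lt a b a b'" if "le b a" "le a b'"
    using that assms ord.le_less unfolding goedel_lt_def by blast
  moreover have "goedel_lt a b a b'" if "le b a" "le b' a"
    using that assms unfolding goedel_lt_def by blast
  ultimately show ?thesis using assms ord.linear ord.less_imp_le ord.order.trans by blast
qed

lemma goedel_iso_inj:
  assumes "goedel_iso R" "R a b c" "R a' b' c"
  shows "a = a' \<and> b = b'"
  using assms goedel_lt_total[of a b a' b'] ord.less_irrefl unfolding goedel_iso_def by blast

text \<open>Uniqueness of an isomorphism between well-orders. Let \<open>m\<close> be the least
  value that \<open>R\<close> gives to some pair while \<open>R'\<close> does not, and compare it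
  with the value \<open>c'\<close> that \<open>R'\<close> gives to this pair.\<close>

lemma goedel_iso_unique:
  assumes R: "goedel_iso (aux_rel R)" and R': "goedel_iso (aux_rel R')" and c: "aux_rel R a b c"
  shows "aux_rel R' a b c"
proof (rule ccontr)
  assume no: "\<not> aux_rel R' a b c"
  let ?F = "\<^bold>\<exists>a. \<^bold>\<exists>b. aux_mem a b (lvl 0) (clvl 0) \<^bold>\<and> (\<^bold>\<not> aux_mem a b (lvl 0) (clvl 1))"
  have F: "S ?F ([] @ [c]) [R, R'] \<longleftrightarrow> (\<exists>a b. aux_rel R a b c \<and> \<not> aux_rel R' a b c)" for c by simp
  have "S ?F ([] @ [c]) [R, R']" unfolding F using c no by blast
  then obtain m where m: "S ?F ([] @ [m]) [R, R']" and le: "\<And>c. S ?F ([] @ [c]) [R, R'] \<Longrightarrow> le m c"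
    by (rule least) blast
  from m obtain a b where ab: "aux_rel R a b m" "\<not> aux_rel R' a b m" unfolding F by blast
  have below: "aux_rel R' x y z" if "lt z m" "aux_rel R x y z" for x y z
    using le[of z] that ord.not_less unfolding F by blast
  obtain c' where c': "aux_rel R' a b c'" using R' unfolding goedel_iso_def by blast
  with ab have "c' \<noteq> m" by blast
  then consider "lt c' m" | "lt m c'" using ord.neq_iff by blast
  then show False
  proof cases
    case 1
    \<comment> \<open>Below \<open>m\<close> every value of \<open>R\<close> is also one of
      \<open>R'\<close>. So the pair with \<open>R\<close>-value \<open>c'\<close> is
      \<open>(a, b)\<close> by injectivity of \<open>R'\<close>, and \<open>R\<close> gives it the
      two values \<open>c'\<close> and \<open>m\<close>.\<close>
    obtain a2 b2 where 2: "aux_rel R a2 b2 c'" using R unfolding goedel_iso_def by blast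
    then have "aux_rel R' a2 b2 c'" using below 1 by blast
    then have "a2 = a \<and> b2 = b" using goedel_iso_inj[OF R' _ c'] by blast
    then show False using 2 ab(1) \<open>c' \<noteq> m\<close> R unfolding goedel_iso_def by blast
  next
    case 2
    \<comment> \<open>The pair with \<open>R'\<close>-value \<open>m\<close> precedes
      \<open>(a, b)\<close>. Its \<open>R\<close>-value \<open>c2\<close> lies below
      \<open>m\<close>, hence is also its \<open>R'\<close>-value, so \<open>R'\<close> gives it two
      values.\<close>
    obtain a2 b2 where a2: "aux_rel R' a2 b2 m" using R' unfolding goedel_iso_def by blast
    then have g: "goedel_lt a2 b2 a b" using 2 c' R' unfolding goedel_iso_def by blast
    obtain c2 where c2: "aux_rel R a2 b2 c2" using R unfolding goedel_iso_def by blast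
    then have "lt c2 m" using g ab(1) R unfolding goedel_iso_def by blast
    moreover from this have "aux_rel R' a2 b2 c2" using below c2 by blast
    then have "c2 = m" using a2 R' unfolding goedel_iso_def by blast
    ultimately show False by simp
  qed
qed

text \<open>The existence of the pairing function need not be derived from the arithmetical axioms: without
  it \<open>pairm\<close> would be identically false, so that no class would be a regular encoding,
  contrary to \<open>MU\<close>.\<close>

lemma ex_goedel_iso: "\<exists>R. goedel_iso (aux_rel R)"
proof (rule ccontr)
  assume no: "\<not> ?thesis"
  obtain X where "\<forall>a. \<not> mem a X" using comprehension[of "\<^bold>\<bottom>" "[]" "[]"] by auto
  then have "bdd X a" for a by (simp add: bdd_def)
  moreover have "S (\<^bold>\<forall>\<^sub>cg. bounded_f g \<^bold>\<longrightarrow> (\<^bold>\<exists>\<^sub>cE. is_reg_encoding E \<^bold>\<and> encoded_in g E)) [] []"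
    using S_sentence by (simp add: MC_A_def MU_def[symmetric] del: S_all)
  then have "\<forall>g. (\<exists>a. bdd g a) \<longrightarrow> (\<exists>E. reg_encoding E \<and> (\<exists>a. \<forall>b. mem b g \<longleftrightarrow> pairm b a E))"
    by simp
  ultimately obtain E where E: "reg_encoding E" by blast
  \<comment> \<open>Two different ordinals refute the first conjunct of \<open>reg_encoding\<close>
    if both have the empty extension.\<close>
  obtain x y where "lt x y" using ex_limit unfolding ex_limit_def by blast
  then have "x \<noteq> y" using ord.less_irrefl by blast
  moreover have "\<forall>x y. (\<forall>b. pairm b x E \<longleftrightarrow> pairm b y E) \<longrightarrow> x = y"
    using E unfolding reg_encoding_def by (rule conjunct1)
  ultimately obtain b where "pairm b x E \<noteq> pairm b y E" by blast
  then show False using no unfolding pairm_def pair_def by blast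
qed

definition pr :: "'o \<Rightarrow> 'o \<Rightarrow> 'o" where
  "pr a b = (THE c. pair a b c)"

text \<open>\<open>pair\<close> quantifies over all classes coding an isomorphism. By uniqueness a
  single one can stand for it, so its properties are those of a function.\<close>

lemma pair_iff: "pair a b c \<longleftrightarrow> c = pr a b"
  and pr_less: "lt (pr a b) (pr a' b') \<longleftrightarrow> goedel_lt a b a' b'"
proof -
  obtain R where R: "goedel_iso (aux_rel R)" using ex_goedel_iso by blast
  have pair: "pair a b c \<longleftrightarrow> aux_rel R a b c" for a b c
    unfolding pair_def using R goedel_iso_unique by blast
  have ex1: "\<exists>!c. pair a b c" for a b using R unfolding pair goedel_iso_def by blast
  show iff: "pair a b c \<longleftrightarrow> c = pr a b" for a b c
    unfolding pr_def using theI'[OF ex1[of a b]] ex1[of a b] by blast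
  have "pair a b c \<Longrightarrow> pair a' b' c' \<Longrightarrow> goedel_lt a b a' b' \<longleftrightarrow> lt c c'" for a b c a' b' c'
    using R unfolding pair goedel_iso_def by blast
  then show "lt (pr a b) (pr a' b') \<longleftrightarrow> goedel_lt a b a' b'"
    using iff by blast
qed

lemma pr_inj [simp]: "pr a b = pr a' b' \<longleftrightarrow> a = a' \<and> b = b'"
  using goedel_lt_total pr_less ord.less_irrefl by metis

text \<open>A strictly increasing function on a well-order never falls below the identity: if
  \<open>m\<close> is least with \<open>pr m b\<close> below \<open>m\<close>, then
  \<open>pr m b\<close> is a smaller such element.\<close>

lemma le_pr1: "le a (pr a b)"
proof (rule ccontr)
  assume "\<not> le a (pr a b)"
  then have "lt (pr a b) a" by (simp add: ord.not_le)
  then obtain m where m: "lt (pr m b) m" "\<And>a. lt (pr a b) a \<Longrightarrow> le m a"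
    using least[of "\<^bold>\<exists>c. is_pair (lvl 1) (lvl 0) c \<^bold>\<and> c \<^bold>< lvl 1" "[b]" a "[]"] by (auto simp: pair_iff)
  have "lt (pr (pr m b) b) (pr m b)" using m(1) by (simp add: pr_less goedel_lt_mono1)
  then have "le m (pr m b)" by (rule m(2))
  then show False using m(1) by (simp add: ord.not_le[symmetric])
qed

lemma le_pr2: "le b (pr a b)"
proof (rule ccontr)
  assume "\<not> le b (pr a b)"
  then have "lt (pr a b) b" by (simp add: ord.not_le)
  then obtain m where m: "lt (pr a m) m" "\<And>b. lt (pr a b) b \<Longrightarrow> le m b"
    using least[of "\<^bold>\<exists>c. is_pair (lvl 0) (lvl 1) c \<^bold>\<and> c \<^bold>< lvl 1" "[a]" b "[]"] by (auto simp: pair_iff)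
  have "lt (pr a (pr a m)) (pr a m)" using m(1) by (simp add: pr_less goedel_lt_mono2)
  then have "le m (pr a m)" by (rule m(2))
  then show False using m(1) by (simp add: ord.not_le[symmetric])
qed

text \<open>That there is no last ordinal is read off the pairing: \<open>pr a' x\<close> exceeds
  \<open>pr a x\<close>, which is at least \<open>x\<close>.\<close>

lemma ex_greater: "\<exists>y. lt x y"
proof -
  obtain a a' where "lt a a'" using ex_limit unfolding ex_limit_def by blast
  then have "lt (pr a x) (pr a' x)" by (simp add: pr_less goedel_lt_mono1)
  then show ?thesis using le_pr2[of x a] ord.order.strict_trans1 by blast
qed

lemma pairm_iff: "pairm a b X \<longleftrightarrow> mem (pr a b) X"
  by (auto simp: pairm_def pair_iff)

lemma ex_sec: "\<exists>D. sec C a D"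
  using comprehension[of "pair_mem (lvl 0) (lvl 1) (clvl 0)" "[a]" "[C]"] by (simp add: sec_def)

lemma ex_restr: "\<exists>R. restr P a R"
  using comprehension[of "lvl 1 \<^bold>\<in> clvl 0 \<^bold>\<and> (\<^bold>\<exists>\<beta>. \<^bold>\<exists>\<gamma>. \<beta> \<^bold>< lvl 0 \<^bold>\<and> is_pair \<beta> \<gamma> (lvl 1))" "[a]" "[P]"]
  by (simp add: restr_def)

lemma sec_restr: "restr Q \<beta> R \<Longrightarrow> lt \<gamma> \<beta> \<Longrightarrow> sec R \<gamma> Y \<longleftrightarrow> sec Q \<gamma> Y"
  unfolding sec_def restr_def pairm_iff pair_iff by auto

lemma ex_segment: "\<exists>X. \<forall>a. mem a X \<longleftrightarrow> lt a \<tau>"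
  using comprehension[of "lvl 1 \<^bold>< lvl 0" "[\<tau>]" "[]"] by simp

text \<open>The last conjunct expresses without reference to \<open>ssup\<close> that the strict supremum of \<open>X\<close> is
  minimal.\<close>

definition next_class :: "'c \<Rightarrow> 'o \<Rightarrow> 'c \<Rightarrow> bool" where
  "next_class Q \<alpha> X \<longleftrightarrow> (\<exists>\<sigma>. bdd X \<sigma>) \<and> (\<forall>\<beta>. lt \<beta> \<alpha> \<longrightarrow> \<not> sec Q \<beta> X) \<and>
     (\<forall>\<sigma> Y. bdd Y \<sigma> \<and> (\<forall>\<beta>. lt \<beta> \<alpha> \<longrightarrow> \<not> sec Q \<beta> Y) \<longrightarrow> bdd X \<sigma>)"

definition next_class_f :: "ctm \<Rightarrow> otm \<Rightarrow> ctm \<Rightarrow> form" where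
  "next_class_f Q \<alpha> X = (bounded_f X \<^bold>\<and> (\<^bold>\<forall>\<beta>. \<beta> \<^bold>< \<alpha> \<^bold>\<longrightarrow> (\<^bold>\<not> is_section Q \<beta> X)) \<^bold>\<and>
     (\<^bold>\<forall>\<sigma>. \<^bold>\<forall>\<^sub>cY. bounded_by Y \<sigma> \<^bold>\<and> (\<^bold>\<forall>\<beta>. \<beta> \<^bold>< \<alpha> \<^bold>\<longrightarrow> (\<^bold>\<not> is_section Q \<beta> Y)) \<^bold>\<longrightarrow> bounded_by X \<sigma>))"

lemma S_next_class [simp]:
  "i < length ws \<Longrightarrow> j < length vs \<Longrightarrow> k < length ws \<Longrightarrow>
   S (next_class_f (clvl i) (lvl j) (clvl k)) vs ws \<longleftrightarrow> next_class (ws ! i) (vs ! j) (ws ! k)"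
  by (simp add: next_class_f_def next_class_def nth_append)

text \<open>Only sections strictly below \<open>\<gamma>\<close> enter, so
  \<open>\<gamma> = \<beta>\<close> is allowed. This case lets the conditions that
  \<open>TDC\<close> imposes on restrictions be read as conditions on the sequence itself.\<close>

lemma next_class_restr:
  assumes "restr Q \<beta> R" "le \<gamma> \<beta>"
  shows "next_class R \<gamma> X \<longleftrightarrow> next_class Q \<gamma> X"
proof -
  have "sec R \<delta> Y \<longleftrightarrow> sec Q \<delta> Y" if "lt \<delta> \<gamma>" for \<delta> Y
    using assms that sec_restr ord.less_le_trans by blast
  then show ?thesis unfolding next_class_def by simp
qed

text \<open>By Replacement the least bounds of the earlier classes stay below some
  \<open>\<tau>\<close>, so a longer initial segment of the ordinals is a new bounded class. Among
  all bounds of new classes a least one is then taken.\<close>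

lemma ex_next_class:
  assumes "\<And>\<beta> X. lt \<beta> \<alpha> \<Longrightarrow> sec Q \<beta> X \<Longrightarrow> \<exists>\<sigma>. bdd X \<sigma>"
  shows "\<exists>X. next_class Q \<alpha> X"
proof -
  \<comment> \<open>Replacement needs a unique value for each index, which an arbitrary bound is
    not; hence the least bound.\<close>
  let ?least = "\<lambda>X \<delta>. bdd X \<delta> \<and> (\<forall>\<delta>'. bdd X \<delta>' \<longrightarrow> le \<delta> \<delta>')"
  let ?F = "\<^bold>\<exists>\<^sub>cX. is_section (clvl 0) (lvl 1) X \<^bold>\<and> bounded_by X (lvl 0) \<^bold>\<and>
    (\<^bold>\<forall>\<delta>'. bounded_by X \<delta>' \<^bold>\<longrightarrow> lvl 0 \<^bold>\<le> \<delta>')"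
  have F: "S ?F ([] @ [\<delta>, \<gamma>]) [Q] \<longleftrightarrow> (\<exists>X. sec Q \<gamma> X \<and> ?least X \<delta>)" for \<gamma> \<delta> by simp
  have sec1: "sec Q \<gamma> X \<Longrightarrow> sec Q \<gamma> Y \<Longrightarrow> X = Y" for \<gamma> X Y
    unfolding sec_def by (auto intro: extensionality)
  have ex1: "\<exists>!\<delta>. \<exists>X. sec Q \<gamma> X \<and> ?least X \<delta>" if \<gamma>: "lt \<gamma> \<alpha>" for \<gamma>
  proof -
    obtain X where X: "sec Q \<gamma> X" using ex_sec by blast
    then obtain \<sigma> where "bdd X \<sigma>" using assms \<gamma> by blast
    then obtain \<delta> where \<delta>: "?least X \<delta>"
      using least[of "bounded_by (clvl 0) (lvl 0)" "[]" \<sigma> "[X]"] by auto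
    show ?thesis
    proof (rule ex1I[of _ \<delta>])
      show "\<exists>X. sec Q \<gamma> X \<and> ?least X \<delta>" using X \<delta> by blast
    next
      fix \<delta>'
      assume "\<exists>X. sec Q \<gamma> X \<and> ?least X \<delta>'"
      then have "?least X \<delta>'" using sec1[OF X] by blast
      then show "\<delta>' = \<delta>" using \<delta> ord.order.antisym by blast
    qed
  qed
  obtain \<tau> where \<tau>: "\<And>\<gamma>. lt \<gamma> \<alpha> \<Longrightarrow> \<exists>\<delta>. lt \<delta> \<tau> \<and> (\<exists>X. sec Q \<gamma> X \<and> ?least X \<delta>)"
    by (rule replacement[of \<alpha> ?F "[]" "[Q]", unfolded F, OF ex1]) blast+
  \<comment> \<open>Going strictly beyond \<open>\<tau>\<close> makes \<open>\<tau>\<close> an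
    element of the segment, which therefore has no bound below \<open>\<tau>\<close>.\<close>
  obtain \<tau>' where \<tau>': "lt \<tau> \<tau>'" using ex_greater by blast
  obtain I where I: "\<forall>a. mem a I \<longleftrightarrow> lt a \<tau>'" using ex_segment by blast
  have "\<not> sec Q \<gamma> I" if \<gamma>: "lt \<gamma> \<alpha>" for \<gamma>
  proof
    assume "sec Q \<gamma> I"
    then obtain \<delta> where "lt \<delta> \<tau>" "bdd I \<delta>" using \<tau>[OF \<gamma>] sec1 by blast
    then show False using I \<tau>' ord.less_asym unfolding bdd_def by blast
  qed
  moreover have "bdd I \<tau>'" using I unfolding bdd_def by blast
  ultimately have ex: "\<exists>Y. bdd Y \<tau>' \<and> (\<forall>\<beta>. lt \<beta> \<alpha> \<longrightarrow> \<not> sec Q \<beta> Y)" by blast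
  let ?G = "\<^bold>\<exists>\<^sub>cY. bounded_by Y (lvl 1) \<^bold>\<and> (\<^bold>\<forall>\<beta>. \<beta> \<^bold>< lvl 0 \<^bold>\<longrightarrow> (\<^bold>\<not> is_section (clvl 0) \<beta> Y))"
  have G: "S ?G ([\<alpha>] @ [\<sigma>]) [Q] \<longleftrightarrow> (\<exists>Y. bdd Y \<sigma> \<and> (\<forall>\<beta>. lt \<beta> \<alpha> \<longrightarrow> \<not> sec Q \<beta> Y))" for \<sigma> by simp
  obtain \<sigma> where "\<exists>Y. bdd Y \<sigma> \<and> (\<forall>\<beta>. lt \<beta> \<alpha> \<longrightarrow> \<not> sec Q \<beta> Y)"
    and \<sigma>: "\<And>\<sigma>'. \<exists>Y. bdd Y \<sigma>' \<and> (\<forall>\<beta>. lt \<beta> \<alpha> \<longrightarrow> \<not> sec Q \<beta> Y) \<Longrightarrow> le \<sigma> \<sigma>'"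
    by (rule least[of ?G "[\<alpha>]" \<tau>' "[Q]", unfolded G, OF ex]) blast
  then obtain Y where Y: "bdd Y \<sigma>" "\<forall>\<beta>. lt \<beta> \<alpha> \<longrightarrow> \<not> sec Q \<beta> Y" by blast
  \<comment> \<open>Whatever bounds a candidate is at least \<open>\<sigma>\<close>, so this upward
    closure yields the last conjunct of \<open>next_class\<close>.\<close>
  have "bdd Y \<sigma>'" if "le \<sigma> \<sigma>'" for \<sigma>'
    using Y(1) that ord.less_le_trans unfolding bdd_def by blast
  then have "next_class Q \<alpha> Y" unfolding next_class_def using Y \<sigma> by blast
  then show ?thesis by blast
qed

lemma ex_enumeration: "\<exists>P. \<forall>\<alpha> X. sec P \<alpha> X \<longrightarrow> next_class P \<alpha> X"
proof -
  \<comment> \<open>The biconditional in \<open>TDC\<close> demands that a continuation exist only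
    if all earlier choices were correct. A next class may also exist after a wrong choice, so the
    formula has to record the correctness of the past.\<close>
  let ?F = "next_class_f (clvl 0) (lvl 0) (clvl 1) \<^bold>\<and>
    (\<^bold>\<forall>\<beta>. \<beta> \<^bold>< lvl 0 \<^bold>\<longrightarrow> (\<^bold>\<forall>\<^sub>cZ. is_section (clvl 0) \<beta> Z \<^bold>\<longrightarrow> next_class_f (clvl 0) \<beta> Z))"
  let ?past = "\<lambda>Q \<alpha>. \<forall>\<beta>. lt \<beta> \<alpha> \<longrightarrow> (\<forall>Z. sec Q \<beta> Z \<longrightarrow> next_class Q \<beta> Z)"
  have F: "S ?F [\<alpha>] [Q, X] \<longleftrightarrow> next_class Q \<alpha> X \<and> ?past Q \<alpha>" for \<alpha> Q X by simp
  have restr: "S ?F [\<beta>] [R, X] \<longleftrightarrow> next_class Q \<beta> X \<and> ?past Q \<beta>" if "restr Q \<beta> R" for Q R \<beta> X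
    unfolding F using that next_class_restr sec_restr ord.less_imp_le ord.order.refl by blast
  have "(\<exists>X. S ?F [\<alpha>] [Q, X]) \<longleftrightarrow>
      (\<forall>\<beta>. lt \<beta> \<alpha> \<longrightarrow> (\<forall>X R. sec Q \<beta> X \<and> restr Q \<beta> R \<longrightarrow> S ?F [\<beta>] [R, X]))" for \<alpha> Q
  proof -
    have "(\<exists>X. S ?F [\<alpha>] [Q, X]) \<longleftrightarrow> ?past Q \<alpha>"
      unfolding F using ex_next_class[of \<alpha> Q] unfolding next_class_def by blast
    also have "\<dots> \<longleftrightarrow> (\<forall>\<beta>. lt \<beta> \<alpha> \<longrightarrow> (\<forall>X R. sec Q \<beta> X \<and> restr Q \<beta> R \<longrightarrow> S ?F [\<beta>] [R, X]))"
      using restr ex_restr ord.less_trans by blast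
    finally show ?thesis .
  qed
  then obtain P where "\<And>\<alpha> X R. sec P \<alpha> X \<Longrightarrow> restr P \<alpha> R \<Longrightarrow> S ?F [\<alpha>] [R, X]"
    using tdc[of ?F] by blast
  then show ?thesis using restr ex_restr by blast
qed

theorem ex_maximal_reg_encoding:
  "\<exists>E. reg_encoding E \<and> (\<forall>g. (\<exists>a. bdd g a) \<longrightarrow> (\<exists>a. \<forall>b. mem b g \<longleftrightarrow> pairm b a E))"
proof -
  obtain P where P: "\<And>\<alpha> X. sec P \<alpha> X \<Longrightarrow> next_class P \<alpha> X" using ex_enumeration by blast
  define U where "U = (\<lambda>\<alpha>. SOME X. sec P \<alpha> X)"
  have sec: "sec P \<alpha> X \<longleftrightarrow> X = U \<alpha>" for \<alpha> X
  proof -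
    have "sec P \<alpha> (U \<alpha>)" unfolding U_def using ex_sec by (rule someI_ex)
    then show ?thesis unfolding sec_def by (auto intro: extensionality)
  qed
  have memU: "mem b (U \<alpha>) \<longleftrightarrow> mem (pr \<alpha> b) P" for \<alpha> b
    using sec[of \<alpha> "U \<alpha>"] by (simp add: sec_def pairm_iff)
  have bddU: "\<exists>\<sigma>. bdd (U \<alpha>) \<sigma>" and distinct: "lt \<beta> \<alpha> \<Longrightarrow> U \<alpha> \<noteq> U \<beta>"
    and minimal: "bdd Y \<sigma> \<Longrightarrow> (\<And>\<beta>. lt \<beta> \<alpha> \<Longrightarrow> Y \<noteq> U \<beta>) \<Longrightarrow> bdd (U \<alpha>) \<sigma>" for \<alpha> \<beta> \<sigma> Y
    using P[of \<alpha> "U \<alpha>"] unfolding sec next_class_def by blast+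
  have inj: "U \<alpha> = U \<beta> \<Longrightarrow> \<alpha> = \<beta>" for \<alpha> \<beta> using distinct ord.less_linear by metis
  \<comment> \<open>\<open>U \<beta>\<close> differs from all classes before stage
    \<open>\<alpha>\<close>, so it competes there and \<open>U \<alpha>\<close> obeys each of its
    bounds.\<close>
  have mono: "bdd (U \<alpha>) \<sigma>" if "le \<alpha> \<beta>" "bdd (U \<beta>) \<sigma>" for \<alpha> \<beta> \<sigma>
    using minimal[OF that(2), of \<alpha>] that(1) distinct ord.less_le_trans by blast
  have surj: "\<exists>\<alpha>. g = U \<alpha>" if g: "bdd g \<tau>" for g \<tau>
  proof (rule ccontr)
    assume "\<nexists>\<alpha>. g = U \<alpha>"
    \<comment> \<open>A class never chosen competes at every stage.\<close>
    then have U\<tau>: "bdd (U \<alpha>) \<tau>" for \<alpha> using minimal[OF g] by blast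
    obtain C \<kappa> where C: "bdd C \<kappa>" "\<And>D b. bdd D \<tau> \<Longrightarrow> mem b D \<Longrightarrow> \<exists>\<xi>. sec C \<xi> D"
      using uniform_encodability by blast
    let ?G = "\<lambda>\<delta> \<xi>. \<^bold>\<exists>\<^sub>cX. is_section (clvl 0) \<xi> X \<^bold>\<and> is_section (clvl 1) \<delta> X"
    \<comment> \<open>The map sends \<open>\<xi>\<close> to the \<open>\<delta>\<close> for which
      the section of \<open>C\<close> at \<open>\<xi>\<close> is \<open>U \<delta>\<close>.
      Replacement asks for a total function, so the remaining indices receive the default
      \<open>\<kappa>\<close>.\<close>
    let ?F = "?G (lvl 1) (lvl 2) \<^bold>\<or> ((\<^bold>\<forall>\<delta>. \<^bold>\<not> ?G \<delta> (lvl 2)) \<^bold>\<and> lvl 1 \<^bold>= lvl 0)"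
    have F: "S ?F ([\<kappa>] @ [\<delta>, \<xi>]) [C, P] \<longleftrightarrow>
        sec C \<xi> (U \<delta>) \<or> (\<forall>\<delta>. \<not> sec C \<xi> (U \<delta>)) \<and> \<delta> = \<kappa>" for \<delta> \<xi>
      by (auto simp: sec)
    have secC: "sec C \<xi> X \<Longrightarrow> sec C \<xi> Y \<Longrightarrow> X = Y" for \<xi> X Y
      unfolding sec_def by (auto intro: extensionality)
    have ex1: "\<exists>!\<delta>. sec C \<xi> (U \<delta>) \<or> (\<forall>\<delta>. \<not> sec C \<xi> (U \<delta>)) \<and> \<delta> = \<kappa>" for \<xi>
      using secC inj by (cases "\<exists>\<delta>. sec C \<xi> (U \<delta>)") blast+
    obtain \<beta> where \<beta>: "\<And>\<xi>. lt \<xi> \<kappa> \<Longrightarrow>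
        \<exists>\<delta>. lt \<delta> \<beta> \<and> (sec C \<xi> (U \<delta>) \<or> (\<forall>\<delta>. \<not> sec C \<xi> (U \<delta>)) \<and> \<delta> = \<kappa>)"
      by (rule replacement[of \<kappa> ?F "[\<kappa>]" "[C, P]", unfolded F, OF ex1]) blast
    obtain \<beta>' where \<beta>': "lt \<beta> \<beta>'" using ex_greater by blast
    \<comment> \<open>\<open>UE\<close> encodes only non-empty classes. Of two different classes at
      least one is non-empty, which gives a suitable index not below \<open>\<beta>\<close>.\<close>
    obtain b where "mem b (U \<beta>) \<noteq> mem b (U \<beta>')"
      using distinct[OF \<beta>'] extensionality[of "U \<beta>" "U \<beta>'"] by metis
    moreover have "le \<beta> \<beta>" "le \<beta> \<beta>'" using \<beta>' by (simp_all add: ord.less_imp_le)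
    ultimately obtain \<alpha> where \<alpha>: "le \<beta> \<alpha>" "mem b (U \<alpha>)" by metis
    obtain \<xi> where \<xi>: "sec C \<xi> (U \<alpha>)" using C(2)[OF U\<tau> \<alpha>(2)] by blast
    with \<alpha>(2) have "mem (pr \<xi> b) C" by (simp add: sec_def pairm_iff)
    \<comment> \<open>A pair is at least its first component, so the bound of \<open>C\<close> also
      bounds the indices of its non-empty sections.\<close>
    then have "lt \<xi> \<kappa>" using C(1) le_pr1[of \<xi> b] ord.order.strict_trans1 unfolding bdd_def by blast
    then obtain \<delta> where "lt \<delta> \<beta>" "sec C \<xi> (U \<delta>)" using \<beta> \<xi> by blast
    then show False using secC[OF \<xi>] inj[of \<alpha> \<delta>] \<alpha>(1) ord.not_le by blast
  qed
  \<comment> \<open>At a least failure \<open>m\<close> the segment below \<open>m\<close>, itself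
    bounded by \<open>m\<close>, must have been used at some \<open>\<beta>\<close> below
    \<open>m\<close>, by minimality of \<open>U m\<close>. Then \<open>\<beta>\<close> belongs to
    \<open>U \<beta>\<close>, although \<open>U \<beta>\<close> is bounded by
    \<open>\<beta>\<close>.\<close>
  have self: "bdd (U \<xi>) \<xi>" for \<xi>
  proof (rule ccontr)
    let ?F = "\<^bold>\<exists>\<^sub>cX. is_section (clvl 0) (lvl 0) X \<^bold>\<and> (\<^bold>\<not> bounded_by X (lvl 0))"
    assume "\<not> bdd (U \<xi>) \<xi>"
    then obtain m where m: "\<not> bdd (U m) m" "\<And>\<xi>. \<not> bdd (U \<xi>) \<xi> \<Longrightarrow> le m \<xi>"
      using least[of ?F "[]" \<xi> "[P]"] by (auto simp: sec)
    obtain I where I: "\<forall>a. mem a I \<longleftrightarrow> lt a m" using ex_segment by blast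
    then have "bdd I m" unfolding bdd_def by blast
    then obtain \<beta> where \<beta>: "lt \<beta> m" "I = U \<beta>" using minimal m(1) by blast
    then have "mem \<beta> (U \<beta>)" "bdd (U \<beta>) \<beta>" using I m(2) ord.not_le by blast+
    then show False using ord.less_irrefl unfolding bdd_def by blast
  qed
  \<comment> \<open>The components are exchanged: the index comes first in the sequence
    \<open>P\<close>, but second in an encoding.\<close>
  obtain E where "\<forall>z. mem z E \<longleftrightarrow> (\<exists>b x. z = pr b x \<and> mem (pr x b) P)"
    using comprehension[of "\<^bold>\<exists>\<beta>. \<^bold>\<exists>\<xi>. is_pair \<beta> \<xi> (lvl 0) \<^bold>\<and> pair_mem \<xi> \<beta> (clvl 0)" "[]" "[P]"]
    by (auto simp: pair_iff pairm_iff)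
  then have E: "pairm b x E \<longleftrightarrow> mem b (U x)" for b x by (auto simp: pairm_iff memU)
  have reg: "reg_encoding E"
    unfolding reg_encoding_def E
  proof (intro conjI HOL.allI HOL.impI)
    fix x y
    assume "\<forall>b. mem b (U x) \<longleftrightarrow> mem b (U y)"
    then show "x = y" using extensionality inj by blast
  next
    fix x
    assume "\<exists>a. mem a (U x)"
    then show "\<exists>a. mem a (U x) \<and> (\<forall>b. mem b (U x) \<longrightarrow> le a b)"
      using least_mem by blast
  next
    fix c s t \<alpha>
    \<comment> \<open>Even a nonstandard code \<open>c\<close> is just an ordinal parameter of this
      single formula.\<close>
    let ?F = "truth2 (clvl 0) (lvl 0) (lvl 4) (lvl 3) (lvl 1) (lvl 2)"
    have F: "S ?F ([c, s, t] @ [\<delta>, \<gamma>]) [E] \<longleftrightarrow> truth2_s E c \<gamma> \<delta> s t" for \<gamma> \<delta> by simp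
    assume "\<forall>\<gamma>. lt \<gamma> \<alpha> \<longrightarrow> (\<exists>!\<delta>. truth2_s E c \<gamma> \<delta> s t)"
    then have ex1: "\<exists>!\<delta>. truth2_s E c \<gamma> \<delta> s t" if "lt \<gamma> \<alpha>" for \<gamma> using that by simp
    show "\<exists>\<beta>. \<forall>\<gamma>. lt \<gamma> \<alpha> \<longrightarrow> (\<exists>\<delta>. lt \<delta> \<beta> \<and> truth2_s E c \<gamma> \<delta> s t)"
      by (rule replacement[of \<alpha> ?F "[c, s, t]" "[E]", unfolded F, OF ex1]) blast+
  next
    fix x
    show "\<exists>a. \<forall>b. mem b (U x) \<longrightarrow> lt b a" using bddU unfolding bdd_def by blast
  next
    fix c s t \<alpha>
    obtain g where g: "\<forall>b. mem b g \<longleftrightarrow> lt b \<alpha> \<and> truth1_s E c b s t"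
      using comprehension[of "lvl 4 \<^bold>< lvl 3 \<^bold>\<and> truth1 (clvl 0) (lvl 0) (lvl 4) (lvl 1) (lvl 2)"
        "[c, s, t, \<alpha>]" "[E]"] by auto
    then have "bdd g \<alpha>" unfolding bdd_def by blast
    then show "\<exists>x. \<forall>b. mem b (U x) \<longleftrightarrow> lt b \<alpha> \<and> truth1_s E c b s t" using surj g by blast
  next
    fix x a
    assume "mem a (U x)"
    then show "lt a x" using self unfolding bdd_def by blast
  next
    fix x y \<sigma> \<tau>
    assume sup: "sup_of (\<lambda>a. mem a (U x)) \<sigma> \<and> sup_of (\<lambda>a. mem a (U y)) \<tau> \<and> lt \<sigma> \<tau>"
    \<comment> \<open>Regularity compares suprema, which may be attained, while \<open>bdd\<close>
      is strict. The successor of \<open>\<sigma>\<close> mediates: being bounded by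
      \<open>\<sigma>'\<close> means having no element above \<open>\<sigma>\<close>.\<close>
    obtain \<sigma>' where \<sigma>': "lt \<sigma> \<sigma>'" "\<And>z. lt \<sigma> z \<Longrightarrow> le \<sigma>' z"
      using ex_greater[of \<sigma>] least[of "lvl 0 \<^bold>< lvl 1" "[\<sigma>]" _ "[]"] by auto
    have "bdd (U x) \<sigma>'"
      using sup \<sigma>'(1) ord.order.strict_trans1 unfolding sup_of_def bdd_def by blast
    show "lt x y"
    proof (rule ccontr)
      assume "\<not> lt x y"
      then have "bdd (U y) \<sigma>'" using mono[OF _ \<open>bdd (U x) \<sigma>'\<close>] by (simp add: ord.not_less)
      then have "\<forall>a. mem a (U y) \<longrightarrow> le a \<sigma>" using \<sigma>'(2) ord.not_le unfolding bdd_def by metis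
      then have "le \<tau> \<sigma>" using sup unfolding sup_of_def by blast
      then show False using sup ord.not_le by blast
    qed
  qed (rule strict_order ex_limit)+
  have "\<exists>a. \<forall>b. mem b g \<longleftrightarrow> pairm b a E" if "\<exists>a. bdd g a" for g
    using that surj unfolding E by metis
  with reg show ?thesis by blast
qed

end

section \<open>The term model\<close>

definition maximal_encoding :: fm where
  "maximal_encoding =
     sentence (\<^bold>\<exists>\<^sub>cE. is_reg_encoding E \<^bold>\<and> (\<^bold>\<forall>\<^sub>cg. bounded_f g \<^bold>\<longrightarrow> encoded_in g E))"

lemma (in mc_model) sat_maximal_encoding: "sat \<rho>0 \<kappa>0 maximal_encoding"
  unfolding maximal_encoding_def sat_sentence using ex_maximal_reg_encoding by simp

text \<open>The carriers of the term model have to be types, so the Henkin set is a global constant. It is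
  arbitrary if no such set exists, i.e. if the theorem holds.\<close>

definition refutation :: "fm set" where
  "refutation = (SOME H. rename_even ` insert (Imp maximal_encoding Falsum) MC_A \<subseteq> H \<and> henkin_set H)"

typedef ordinal = "range (\<lambda>s. {t. Eq s t \<in> refutation})" by blast
typedef ord_class = "range (\<lambda>X. {Y. EqC X Y \<in> refutation})" by blast

text \<open>\<open>eq_subst\<close> makes provable equality Euclidean; with reflexivity it is an
  equivalence relation, and the sets are its classes.\<close>

lemma henkin_set_Eq:
  assumes "henkin_set H"
  shows "{u. Eq s u \<in> H} = {u. Eq t u \<in> H} \<longleftrightarrow> Eq s t \<in> H"
proof -
  have closed: "H \<turnstile> \<phi> \<longleftrightarrow> \<phi> \<in> H" for \<phi>
    using assms proves.assm unfolding henkin_set_def by blast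
  have refl: "Eq u u \<in> H" for u using proves.eq_refl closed by blast
  have unshift: "tsubst (case_nat s Var) (tsubst (\<lambda>k. Var (Suc k)) t) = t" for s t
    by (simp add: tsubst_tsubst)
  have eucl: "Eq t u \<in> H" if "Eq s t \<in> H" "Eq s u \<in> H" for s t u
    using that proves.eq_subst[of H s t "Eq (Var 0) (tsubst (\<lambda>k. Var (Suc k)) u)"]
    by (simp add: closed inst_o_def unshift)
  then have "Eq t s \<in> H" if "Eq s t \<in> H" for s t using refl that by blast
  with eucl refl show ?thesis by blast
qed

lemma henkin_set_EqC:
  assumes "henkin_set H"
  shows "{Z. EqC X Z \<in> H} = {Z. EqC Y Z \<in> H} \<longleftrightarrow> EqC X Y \<in> H"
proof -
  have closed: "H \<turnstile> \<phi> \<longleftrightarrow> \<phi> \<in> H" for \<phi>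
    using assms proves.assm unfolding henkin_set_def by blast
  have refl: "EqC Z Z \<in> H" for Z using proves.eqC_refl closed by blast
  have eucl: "EqC Y Z \<in> H" if "EqC X Y \<in> H" "EqC X Z \<in> H" for X Y Z
    using that proves.eqC_subst[of H X Y "EqC 0 (Suc Z)"] by (simp add: closed inst_c_def)
  then have "EqC Y X \<in> H" if "EqC X Y \<in> H" for X Y using refl that by blast
  with eucl refl show ?thesis by blast
qed

theorem theorem8:
  shows "MC_A \<turnstile> sentence (\<^bold>\<exists>\<^sub>cE. is_reg_encoding E \<^bold>\<and> (\<^bold>\<forall>\<^sub>cg. bounded_f g \<^bold>\<longrightarrow> encoded_in g E))"
proof (rule ccontr)
  let ?\<Gamma> = "insert (Imp maximal_encoding Falsum) MC_A"
  assume "\<not> ?thesis"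
  then have "consistent (rename_even ` ?\<Gamma>)"
    unfolding maximal_encoding_def[symmetric]
    by (rule consistent_rename_even[OF consistent_insert_neg])
  then have "\<exists>H. rename_even ` ?\<Gamma> \<subseteq> H \<and> henkin_set H"
    by (rule henkin_extension[OF spacious_rename_even])
  then have sub: "rename_even ` ?\<Gamma> \<subseteq> refutation" and H: "henkin_set refutation"
    unfolding refutation_def by (metis (mono_tags, lifting) someI_ex)+
  define qo where "qo = (\<lambda>s. Abs_ordinal {t. Eq s t \<in> refutation})"
  define qc where "qc = (\<lambda>X. Abs_ord_class {Y. EqC X Y \<in> refutation})"
  have "surj qo" unfolding qo_def
    by (metis (no_types, lifting) Abs_ordinal_cases imageE surjI surj_def)
  moreover have "qo s = qo t \<longleftrightarrow> Eq s t \<in> refutation" for s t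
    unfolding qo_def by (subst Abs_ordinal_inject) (auto simp only: henkin_set_Eq[OF H])
  moreover have "surj qc" unfolding qc_def
    by (metis (no_types, lifting) Abs_ord_class_cases imageE surj_def)
  moreover have "qc X = qc Y \<longleftrightarrow> EqC X Y \<in> refutation" for X Y
    unfolding qc_def by (subst Abs_ord_class_inject) (auto simp only: henkin_set_EqC[OF H])
  ultimately obtain lt ad mu mem where sat: "\<And>\<phi> \<sigma> \<tau>.
      two_sorted.sat lt ad mu mem (\<lambda>i. qo (\<sigma> i)) (\<lambda>j. qc (\<tau> j)) \<phi> \<longleftrightarrow> fsubst \<sigma> \<tau> \<phi> \<in> refutation"
    using term_model[OF H, of qo qc] by blast
  \<comment> \<open>Under this assignment the truth of a formula is membership of its even renaming
    in \<open>refutation\<close>, so the original axioms hold.\<close>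
  let ?\<rho> = "\<lambda>i. qo (Var (2 * i))" and ?\<kappa> = "\<lambda>j. qc (2 * j)"
  have true: "two_sorted.sat lt ad mu mem ?\<rho> ?\<kappa> \<phi>" if "\<phi> \<in> ?\<Gamma>" for \<phi>
    using that sub unfolding sat rename_even_def by blast
  interpret mc_model lt ad mu mem ?\<rho> ?\<kappa>
    by unfold_locales (use true in blast)
  show False using true[of "Imp maximal_encoding Falsum"] sat_maximal_encoding by simp
qed

end
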